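(* If $t_0\in(0,\pi)$ and $\lambda_0$ is a multiple eigenvalue of $L_{t_0}$, then $\lambda_0$ is a spectral singularity of $L$ and is not an ESS of $L$.
   Context: Let $q:\mathbb R\to\mathbb C$ be $1$-periodic, Lebesgue integrable on $[0,1]$, with $\int_0^1 q=0$. $L=L(q)$ is the operator in $L_2(-\infty,\infty)$ generated by $l(y)=-y''+qy$. For $t\in\mathbb C$ (taken mod $2\pi$), $L_t$ is the operator in $L_2[0,1]$ generated by $l$ and $y(1)=e^{it}y(0)$, $y'(1)=e^{it}y'(0)$; $\sigma(L)=\bigcup_{t\in(-\pi,\pi]}\sigma(L_t)$. $\theta(x,\lambda),\varphi(x,\lambda)$ are the solutions of $l(y)=\lambda y$ with $\theta(0,\lambda)=\varphi'(0,\lambda)=1$, $\theta'(0,\lambda)=\varphi(0,\lambda)=0$, and $F(\lambda)=\varphi'(1,\lambda)+\theta(1,\lambda)$. The eigenvalues of $L_t$ are the roots of $F(\lambda)=2\cos t$; multiplicity of an eigenvalue means its multiplicity as a root. For real $t$ the eigenvalues, counted with multiplicity, are numbered $\lambda_n(t)$, $n\in\mathbb Z$, so that each $\lambda_n$ is continuous on $[0,\pi]$ (known to be possible); extend by $\lambda_n(-t)=\lambda_n(t)$ and $2\pi$-periodicity. $A_n$ is the (finite) set of $t\in(-\pi,\pi]$ for which $\lambda_n(t)$ is a multiple eigenvalue of $L_t$. $\Psi_{n,t}$ is an eigenfunction of $L_t$ for $\lambda_n(t)$ and $\Psi^*_{n,t}$ an eigenfunction of $L_t^*$ for $\overline{\lambda_n(t)}$,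 both normalized in $L_2[0,1]$ and extended to $\mathbb R$ by multiplication by $e^{it}$ under $x\mapsto x+1$; $\alpha_n(t)=(\Psi_{n,t},\Psi^*_{n,t})$ (inner product of $L_2[0,1]$). Regular spectral arc: a closed arc $\gamma=\{\lambda(t):t\in[\alpha,\beta]\}$ with $\lambda$ analytic in a neighbourhood of the real interval $[\alpha,\beta]$, $F(\lambda(t))=2\cos t$ and $F'(\lambda(t))\ne0$ on $[\alpha,\beta]$, $\lambda'(t)\neq0$ on $(\alpha,\beta)$. For a regular spectral arc $\gamma\subset\{\lambda_n(t):t\in[0,\pi]\}$, with $\delta=\{t\in(-\pi,\pi]:\lambda_n(t)\in\gamma\}$, the projection is $P(\gamma)f=\frac1{2\pi}\int_\delta\frac1{\alpha_n(t)}(f,\Psi^*_{n,t})_{L_2(\mathbb R)}\Psi_{n,t}\,dt$, and $\|P(\gamma)\|=\sup_{t\in\delta}|\alpha_n(t)|^{-1}$. Spectral singularity: $\lambda\in\sigma(L)$ such that for all $\varepsilon>0$ there is a sequence of regular spectral arcs $\gamma_n\subset\{z:|z-\lambda|<\varepsilon\}$ with $\|P(\gamma_n)\|\to\infty$. Essential spectral singularity (ESS): $\lambda_0\in\sigma(L_{\pm t_0})$ for which there is $n\in\mathbb Z$ with $\lambda_0=\lambda_n(t_0)$ such that for each $\varepsilon>0$ the function $1/\alpha_n$ is not integrable on $\big((t_0-\varepsilon,t_0+\varepsilon)\cup(-t_0-\varepsilon,-t_0+\varepsilon)\big)\setminus A_n$. *)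

theory Defs
  imports "HOL-Complex_Analysis.Complex_Analysis"
begin

text \<open>The space \<open>L\<^sub>2[0,1]\<close> is represented by functions, not classes modulo null sets, and an
  operator in it by its graph, a set of pairs of functions.\<close>

definition L2_unit :: "(real \<Rightarrow> complex) set" where
  "L2_unit = {f. f \<in> borel_measurable (lebesgue_on {0..1}) \<and>
                 integrable (lebesgue_on {0..1}) (\<lambda>x. (cmod (f x))\<^sup>2)}"

definition L2_inner :: "(real \<Rightarrow> complex) \<Rightarrow> (real \<Rightarrow> complex) \<Rightarrow> complex" where
  "L2_inner f g = integral\<^sup>L (lebesgue_on {0..1}) (\<lambda>x. f x * cnj (g x))"

definition L2_norm :: "(real \<Rightarrow> complex) \<Rightarrow> real" where
  "L2_norm f = sqrt (integral\<^sup>L (lebesgue_on {0..1}) (\<lambda>x. (cmod (f x))\<^sup>2))"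

type_synonym op_graph = "((real \<Rightarrow> complex) \<times> (real \<Rightarrow> complex)) set"

definition adjoint_graph :: "op_graph \<Rightarrow> op_graph" where
  "adjoint_graph T = {(g, h). g \<in> L2_unit \<and> h \<in> L2_unit \<and>
                              (\<forall>(y, f) \<in> T. L2_inner f g = L2_inner y h)}"

definition resolvent_set :: "op_graph \<Rightarrow> complex set" where
  "resolvent_set T = {z.
     (\<forall>f \<in> L2_unit. \<exists>(y, h) \<in> T. AE x in lebesgue_on {0..1}. h x - z * y x = f x) \<and>
     (\<exists>C. \<forall>(y, h) \<in> T. L2_norm y \<le> C * L2_norm (\<lambda>x. h x - z * y x))}"

definition op_spectrum :: "op_graph \<Rightarrow> complex set" where
  "op_spectrum T = - resolvent_set T"

definition normalized_eigenfunction :: "op_graph \<Rightarrow> complex \<Rightarrow> (real \<Rightarrow> complex) \<Rightarrow> bool" where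
  "normalized_eigenfunction T z y \<longleftrightarrow> (y, \<lambda>x. z * y x) \<in> T \<and> L2_norm y = 1"

definition eigenvalue :: "op_graph \<Rightarrow> complex \<Rightarrow> bool" where
  "eigenvalue T z \<longleftrightarrow> (\<exists>y. (y, \<lambda>x. z * y x) \<in> T \<and> L2_norm y \<noteq> 0)"

definition hill_potential :: "(real \<Rightarrow> complex) \<Rightarrow> bool" where
  "hill_potential q \<longleftrightarrow> (\<forall>x. q (x + 1) = q x) \<and> q absolutely_integrable_on {0..1} \<and>
                        integral {0..1} q = 0"

text \<open>\<open>hill_expr S q y f\<close> expresses \<open>f = -y'' + q y\<close> almost everywhere on the interval \<open>S\<close>,
  where \<open>y\<close> is continuously differentiable and \<open>y'\<close> is locally absolutely continuous on \<open>S\<close>: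
  it says that \<open>y'\<close> is an indefinite Lebesgue integral of \<open>q y - f\<close>.\<close>

definition hill_expr ::
  "real set \<Rightarrow> (real \<Rightarrow> complex) \<Rightarrow> (real \<Rightarrow> complex) \<Rightarrow> (real \<Rightarrow> complex) \<Rightarrow> bool" where
  "hill_expr S q y f \<longleftrightarrow> (\<exists>y1.
     (\<forall>x\<in>S. (y has_vector_derivative y1 x) (at x within S)) \<and>
     (\<forall>a\<in>S. \<forall>b\<in>S. a \<le> b \<longrightarrow>
        (\<lambda>x. q x * y x - f x) absolutely_integrable_on {a..b} \<and>
        y1 b - y1 a = integral {a..b} (\<lambda>x. q x * y x - f x)))"

definition hill_op :: "(real \<Rightarrow> complex) \<Rightarrow> real \<Rightarrow> op_graph" where
  "hill_op q t = {(y, f). y \<in> L2_unit \<and> f \<in> L2_unit \<and> hill_expr {0..1} q y f \<and>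
     y 1 = cis t * y 0 \<and>
     vector_derivative y (at 1 within {0..1}) = cis t * vector_derivative y (at 0 within {0..1})}"

definition hill_spectrum :: "(real \<Rightarrow> complex) \<Rightarrow> complex set" where
  "hill_spectrum q = (\<Union>t\<in>{-pi<..pi}. op_spectrum (hill_op q t))"

definition fundamental_solutions ::
  "(real \<Rightarrow> complex) \<Rightarrow> (real \<Rightarrow> complex \<Rightarrow> complex) \<Rightarrow> (real \<Rightarrow> complex \<Rightarrow> complex) \<Rightarrow> bool" where
  "fundamental_solutions q \<theta> \<phi> \<longleftrightarrow> (\<forall>z.
     hill_expr UNIV q (\<lambda>x. \<theta> x z) (\<lambda>x. z * \<theta> x z) \<and>
     hill_expr UNIV q (\<lambda>x. \<phi> x z) (\<lambda>x. z * \<phi> x z) \<and>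
     \<theta> 0 z = 1 \<and> vector_derivative (\<lambda>x. \<theta> x z) (at 0) = 0 \<and>
     \<phi> 0 z = 0 \<and> vector_derivative (\<lambda>x. \<phi> x z) (at 0) = 1)"

definition hill_discriminant ::
  "(real \<Rightarrow> complex \<Rightarrow> complex) \<Rightarrow> (real \<Rightarrow> complex \<Rightarrow> complex) \<Rightarrow> complex \<Rightarrow> complex" where
  "hill_discriminant \<theta> \<phi> z = vector_derivative (\<lambda>x. \<phi> x z) (at 1) + \<theta> 1 z"

text \<open>Below, \<open>F\<close> stands for the discriminant.\<close>

definition root_multiplicity :: "(complex \<Rightarrow> complex) \<Rightarrow> real \<Rightarrow> complex \<Rightarrow> nat" where
  "root_multiplicity F t z =
     (if F z = 2 * cos (of_real t) then nat (zorder (\<lambda>w. F w - 2 * cos (of_real t)) z) else 0)"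

definition multiple_eigenvalue ::
  "(real \<Rightarrow> complex) \<Rightarrow> (complex \<Rightarrow> complex) \<Rightarrow> real \<Rightarrow> complex \<Rightarrow> bool" where
  "multiple_eigenvalue q F t z \<longleftrightarrow> eigenvalue (hill_op q t) z \<and> root_multiplicity F t z \<ge> 2"

definition eigenvalue_numbering ::
  "(complex \<Rightarrow> complex) \<Rightarrow> (int \<Rightarrow> real \<Rightarrow> complex) \<Rightarrow> bool" where
  "eigenvalue_numbering F ev \<longleftrightarrow>
     (\<forall>t\<in>{0..pi}. \<forall>z. finite {n. ev n t = z} \<and> card {n. ev n t = z} = root_multiplicity F t z) \<and>
     (\<forall>n. continuous_on {0..pi} (ev n)) \<and>
     (\<forall>n t. ev n (- t) = ev n t) \<and>
     (\<forall>n t. ev n (t + 2 * pi) = ev n t)"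

definition multiple_set ::
  "(real \<Rightarrow> complex) \<Rightarrow> (complex \<Rightarrow> complex) \<Rightarrow> (int \<Rightarrow> real \<Rightarrow> complex) \<Rightarrow> int \<Rightarrow> real set" where
  "multiple_set q F ev n = {t \<in> {-pi<..pi}. multiple_eigenvalue q F t (ev n t)}"

definition eigenfunction_system ::
  "(real \<Rightarrow> complex) \<Rightarrow> (int \<Rightarrow> real \<Rightarrow> complex) \<Rightarrow>
   (int \<Rightarrow> real \<Rightarrow> real \<Rightarrow> complex) \<Rightarrow> (int \<Rightarrow> real \<Rightarrow> real \<Rightarrow> complex) \<Rightarrow> bool" where
  "eigenfunction_system q ev \<Psi> \<Psi>s \<longleftrightarrow> (\<forall>n t.
     normalized_eigenfunction (hill_op q t) (ev n t) (\<Psi> n t) \<and>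
     normalized_eigenfunction (adjoint_graph (hill_op q t)) (cnj (ev n t)) (\<Psi>s n t))"

text \<open>Where the eigenvalue is simple, \<open>\<alpha>\<close> is determined by it up to a factor of modulus one,
  which depends on the choice of the two eigenfunctions; \<open>cmod \<circ> \<alpha>\<close> is independent of the choice.\<close>

definition eig_alpha ::
  "(int \<Rightarrow> real \<Rightarrow> real \<Rightarrow> complex) \<Rightarrow> (int \<Rightarrow> real \<Rightarrow> real \<Rightarrow> complex) \<Rightarrow> int \<Rightarrow> real \<Rightarrow> complex" where
  "eig_alpha \<Psi> \<Psi>s n t = L2_inner (\<Psi> n t) (\<Psi>s n t)"

definition regular_spectral_arc :: "(complex \<Rightarrow> complex) \<Rightarrow> complex set \<Rightarrow> bool" where
  "regular_spectral_arc F \<gamma> \<longleftrightarrow> (\<exists>(\<mu> :: complex \<Rightarrow> complex) a b. a < b \<and>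
     \<mu> analytic_on complex_of_real ` {a..b} \<and>
     (\<forall>t\<in>{a..b}. F (\<mu> (of_real t)) = 2 * cos (of_real t) \<and> deriv F (\<mu> (of_real t)) \<noteq> 0) \<and>
     (\<forall>t\<in>{a<..<b}. deriv \<mu> (of_real t) \<noteq> 0) \<and>
     \<gamma> = (\<lambda>t. \<mu> (of_real t)) ` {a..b})"

text \<open>The norm of the projection \<open>P(\<gamma>)\<close> for a regular spectral arc \<open>\<gamma>\<close> lying on the curve
  \<open>ev n ` {0..pi}\<close>, that is, the supremum of \<open>1 / cmod (\<alpha> n t)\<close> over those \<open>t\<close> for which
  \<open>ev n t\<close> is on the arc. It takes values in the extended nonnegative reals.\<close>

definition projection_norm ::
  "(int \<Rightarrow> real \<Rightarrow> complex) \<Rightarrow> (int \<Rightarrow> real \<Rightarrow> complex) \<Rightarrow> int \<Rightarrow> complex set \<Rightarrow> ennreal" where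
  "projection_norm ev \<alpha> n \<gamma> =
     (SUP t\<in>{t \<in> {-pi<..pi}. ev n t \<in> \<gamma>}. inverse (ennreal (cmod (\<alpha> n t))))"

definition spectral_singularity ::
  "(real \<Rightarrow> complex) \<Rightarrow> (complex \<Rightarrow> complex) \<Rightarrow> (int \<Rightarrow> real \<Rightarrow> complex) \<Rightarrow>
   (int \<Rightarrow> real \<Rightarrow> complex) \<Rightarrow> complex \<Rightarrow> bool" where
  "spectral_singularity q F ev \<alpha> z \<longleftrightarrow> z \<in> hill_spectrum q \<and>
     (\<forall>\<epsilon>>0. \<exists>(\<gamma> :: nat \<Rightarrow> complex set) (n :: nat \<Rightarrow> int).
        (\<forall>k. regular_spectral_arc F (\<gamma> k) \<and> \<gamma> k \<subseteq> ev (n k) ` {0..pi} \<and> \<gamma> k \<subseteq> ball z \<epsilon>) \<and>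
        (\<lambda>k. projection_norm ev \<alpha> (n k) (\<gamma> k)) \<longlonglongrightarrow> \<infinity>)"

text \<open>Integrability of \<open>1/\<alpha>\<close> is that of its modulus: a factor of modulus one coming from an
  arbitrary choice of eigenfunctions could be nonmeasurable in \<open>t\<close>.\<close>

definition essential_spectral_singularity ::
  "(real \<Rightarrow> complex) \<Rightarrow> (complex \<Rightarrow> complex) \<Rightarrow> (int \<Rightarrow> real \<Rightarrow> complex) \<Rightarrow>
   (int \<Rightarrow> real \<Rightarrow> complex) \<Rightarrow> complex \<Rightarrow> bool" where
  "essential_spectral_singularity q F ev \<alpha> z \<longleftrightarrow> (\<exists>t\<in>{-pi<..pi}.
     z \<in> op_spectrum (hill_op q t) \<and> z \<in> op_spectrum (hill_op q (- t)) \<and>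
     (\<exists>n. z = ev n t \<and>
        (\<forall>\<epsilon>>0. \<not> set_integrable lebesgue
                 (({t - \<epsilon><..<t + \<epsilon>} \<union> {- t - \<epsilon><..<- t + \<epsilon>}) - multiple_set q F ev n)
                 (\<lambda>s. 1 / cmod (\<alpha> n s)))))"

end

theory Submission
  imports Defs
begin

text \<open>
  Fix a branch \<open>\<lambda>(t)\<close> of eigenvalues and let \<open>t\<close> be no multiple of \<open>\<pi>\<close>. The two Floquet multipliers
  \<open>\<rho> = exp(it)\<close> and \<open>\<sigma> = exp(-it)\<close> are then distinct; let \<open>u\<close> and \<open>v\<close> be the corresponding normalized
  solutions of \<open>l(y) = \<lambda>(t) y\<close>, and \<open>W\<close> their Wronskian, which is not zero. Everything rests on one
  formula,

    \<open>|\<alpha>(t)| K(t) = |F'(\<lambda>(t))|\<close>   with   \<open>K(t) = 2 |sin t| / |W|\<close> continuous and positive.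

  It has three sources. Variation of constants solves \<open>(L\<^sub>t - \<lambda>) y = f\<close> whenever the integral of \<open>f v\<close>
  vanishes, so the adjoint eigenfunction is a unimodular multiple of the conjugate of \<open>v\<close>, and
  \<open>|\<alpha>(t)|\<close> is the modulus of the integral of \<open>u v\<close> (\<open>adjoint_eigenfunction\<close>). Green's identity shows
  that \<open>F\<close> is entire and represents \<open>F'\<close> by integrals of products of \<open>\<theta>\<close> and \<open>\<phi>\<close>
  (\<open>discriminant_has_derivative\<close>); in terms of \<open>u\<close> and \<open>v\<close> this reads
  \<open>F' W = (\<rho> - \<sigma>) \<integral> u v\<close> (\<open>integral_uv\<close>). Finally, \<open>u\<close> and \<open>v\<close> are given only up to phases that need not
  depend on \<open>t\<close> in any regular way, but \<open>1/|W|\<close> is a function of the projection \<open>(M - \<sigma>) / (\<rho> - \<sigma>)\<close>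
  onto an eigenspace of the monodromy matrix \<open>M\<close>, and so it is continuous (\<open>inv_wronskian_eq\<close>,
  \<open>inv_wronskian_tendsto\<close>).

  At a multiple eigenvalue \<open>F'\<close> vanishes. Hence \<open>\<alpha>(t)\<close> tends to \<open>0\<close> as \<open>t\<close> tends to \<open>t\<^sub>0\<close>, and small
  regular arcs around points \<open>\<lambda>(s)\<close> with \<open>s\<close> close to \<open>t\<^sub>0\<close> have projections of arbitrarily large norm:
  the eigenvalue is a spectral singularity. On the other hand \<open>F - F(\<lambda>\<^sub>0)\<close> has a zero of some finite
  order \<open>m\<close>, so \<open>|F'|\<close> is bounded below by a multiple of \<open>|F - F(\<lambda>\<^sub>0)|\<close> to the power \<open>1 - 1/m\<close>
  (\<open>holomorphic_deriv_lower_bound\<close>). On the branch \<open>F - F(\<lambda>\<^sub>0) = 2 cos t - 2 cos t\<^sub>0\<close>, which is of exact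
  order \<open>t - t\<^sub>0\<close> because \<open>sin t\<^sub>0\<close> is not zero. Therefore \<open>1/|\<alpha>(t)|\<close> is at most a multiple of
  \<open>|t - t\<^sub>0|\<close> to the power \<open>-(1 - 1/m)\<close>, which is integrable: there is no essential spectral
  singularity.
\<close>

section \<open>Indefinite Lebesgue integrals on the unit interval\<close>

text \<open>This is absolute continuity of \<open>f\<close> with derivative \<open>h\<close> almost everywhere. It is recorded through the
  integral because \<open>y'\<close> is given in this form for solutions of the differential equation, and because
  the product rule below then needs no almost everywhere differentiation.\<close>

definition unit_primitive :: "(real \<Rightarrow> complex) \<Rightarrow> (real \<Rightarrow> complex) \<Rightarrow> bool" where
  "unit_primitive f h \<longleftrightarrow>
     h absolutely_integrable_on {0..1} \<and> (\<forall>x\<in>{0..1}. f x - f 0 = integral {0..x} h)"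

lemma abs_integrable_mult_continuous:
  fixes h g :: "real \<Rightarrow> complex"
  assumes "h absolutely_integrable_on {a..b}" "continuous_on {a..b} g"
  shows "(\<lambda>x. h x * g x) absolutely_integrable_on {a..b}"
proof -
  have "(\<lambda>x. g x * h x) absolutely_integrable_on {a..b}"
  proof (rule absolutely_integrable_bounded_measurable_product[OF bilinear_times _ _ _ assms(1)])
    show "g \<in> borel_measurable (lebesgue_on {a..b})"
      using assms(2) by (intro continuous_imp_measurable_on_sets_lebesgue) auto
    show "bounded (g ` {a..b})"
      using assms(2) by (intro compact_imp_bounded compact_continuous_image) auto
  qed auto
  then show ?thesis by (simp add: mult.commute)
qed

lemma unit_primitive_abs_integrable:
  assumes "unit_primitive f h" "0 \<le> a" "b \<le> 1"
  shows "h absolutely_integrable_on {a..b}"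
  using assms unfolding unit_primitive_def
  by (meson absolutely_integrable_on_subinterval atLeastatMost_subset_iff)

lemma unit_primitive_integral:
  assumes "unit_primitive f h" "0 \<le> a" "a \<le> b" "b \<le> 1"
  shows "f b - f a = integral {a..b} h"
proof -
  have i: "h integrable_on {0..b}"
    using unit_primitive_abs_integrable[OF assms(1), of 0 b] assms
    by (simp add: set_lebesgue_integral_eq_integral(1))
  have "integral {0..a} h + integral {a..b} h = integral {0..b} h"
    using assms i by (intro Henstock_Kurzweil_Integration.integral_combine) auto
  moreover have "f a - f 0 = integral {0..a} h" "f b - f 0 = integral {0..b} h"
    using assms unfolding unit_primitive_def by auto
  ultimately show ?thesis by (simp add: algebra_simps)
qed

lemma unit_primitive_continuous:
  assumes "unit_primitive f h"
  shows "continuous_on {0..1} f"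
proof -
  have "h integrable_on {0..1}"
    using assms unfolding unit_primitive_def by (simp add: set_lebesgue_integral_eq_integral(1))
  then have c: "continuous_on {0..1} (\<lambda>x. f 0 + integral {0..x} h)"
    by (intro continuous_intros indefinite_integral_continuous_1)
  have "f 0 + integral {0..x} h = f x" if "x \<in> {0..1}" for x
    using assms that unfolding unit_primitive_def by (metis add.commute diff_add_cancel)
  with c show ?thesis by (rule continuous_on_eq)
qed

lemma unit_primitive_add:
  assumes "unit_primitive f h" "unit_primitive g k"
  shows "unit_primitive (\<lambda>x. f x + g x) (\<lambda>x. h x + k x)"
proof -
  have "h absolutely_integrable_on {0..x}" "k absolutely_integrable_on {0..x}" if "x \<in> {0..1}" for x
    using unit_primitive_abs_integrable[OF assms(1)] unit_primitive_abs_integrable[OF assms(2)] that by auto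
  then have "integral {0..x} (\<lambda>x. h x + k x) = integral {0..x} h + integral {0..x} k" if "x \<in> {0..1}" for x
    using that by (intro integral_add) (auto simp: set_lebesgue_integral_eq_integral(1))
  then show ?thesis using assms unfolding unit_primitive_def
    by (simp add: set_integral_add(1) add_diff_add)
qed

lemma unit_primitive_cmult:
  assumes "unit_primitive f h"
  shows "unit_primitive (\<lambda>x. c * f x) (\<lambda>x. c * h x)"
proof -
  have "c * f x - c * f 0 = c * integral {0..x} h" if "x \<in> {0..1}" for x
    using assms that unfolding unit_primitive_def by (metis right_diff_distrib)
  then show ?thesis using assms unfolding unit_primitive_def by simp
qed

lemma unit_primitive_diff:
  assumes "unit_primitive f h" "unit_primitive g k"
  shows "unit_primitive (\<lambda>x. f x - g x) (\<lambda>x. h x - k x)"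
  using unit_primitive_add[OF assms(1) unit_primitive_cmult[OF assms(2), of "-1"]] by simp

lemma unit_primitive_const: "unit_primitive (\<lambda>x. c) (\<lambda>x. 0)"
  by (simp add: unit_primitive_def)

lemma unit_primitive_cong:
  assumes "unit_primitive f h" "\<And>x. x \<in> {0..1} \<Longrightarrow> f x = g x" "\<And>x. x \<in> {0..1} \<Longrightarrow> h x = k x"
  shows "unit_primitive g k"
proof -
  have "h absolutely_integrable_on {0..1} \<longleftrightarrow> k absolutely_integrable_on {0..1}"
    by (rule set_integrable_cong) (use assms(3) in auto)
  then have "k absolutely_integrable_on {0..1}"
    using assms(1) unfolding unit_primitive_def by blast
  moreover have "integral {0..x} k = integral {0..x} h" if "x \<in> {0..1}" for x
    using that assms(3) by (intro integral_cong) auto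
  ultimately show ?thesis using assms unfolding unit_primitive_def by auto
qed

lemma unit_primitive_indefinite:
  assumes "h absolutely_integrable_on {0..1}"
  shows "unit_primitive (\<lambda>x. integral {0..x} h) h"
  using assms by (simp add: unit_primitive_def)

text \<open>The defect \<open>E\<close> between the two sides changes over a short interval by at most \<open>e\<close> times the integral
  of \<open>|h| + |k|\<close>, where \<open>e\<close> bounds the oscillation of \<open>f\<close> and \<open>g\<close>. This bound is additive in the interval,
  so it holds for all intervals and every positive \<open>e\<close>.\<close>

lemma unit_primitive_mult:
  assumes f: "unit_primitive f h" and g: "unit_primitive g k"
  shows "unit_primitive (\<lambda>x. f x * g x) (\<lambda>x. h x * g x + f x * k x)"
proof -
  note cf = unit_primitive_continuous[OF f] and cg = unit_primitive_continuous[OF g]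
  have h: "h absolutely_integrable_on {0..1}" and k: "k absolutely_integrable_on {0..1}"
    using f g by (auto simp: unit_primitive_def)
  define r where "r x = h x * g x + f x * k x" for x
  have r: "r absolutely_integrable_on {0..1}"
    unfolding r_def using abs_integrable_mult_continuous[OF h cg] abs_integrable_mult_continuous[OF k cf]
    by (intro set_integral_add(1)) (simp_all add: mult.commute)
  define H where "H x = integral {0..x} (\<lambda>x. cmod (h x) + cmod (k x))" for x
  define E where "E x = f x * g x - integral {0..x} r" for x
  have sub: "p absolutely_integrable_on {a..b}" if "p absolutely_integrable_on {0..1}" "0 \<le> a" "b \<le> 1"
    for p :: "real \<Rightarrow> complex" and a b
    using that by (meson absolutely_integrable_on_subinterval atLeastatMost_subset_iff)
  have hk: "(\<lambda>x. cmod (h x) + cmod (k x)) integrable_on {a..b}" if "0 \<le> a" "b \<le> 1" for a b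
    using sub[OF h that] sub[OF k that]
    by (intro integrable_add) (auto simp: absolutely_integrable_on_def)
  have Hd: "H b - H a = integral {a..b} (\<lambda>x. cmod (h x) + cmod (k x))" if "0 \<le> a" "a \<le> b" "b \<le> 1" for a b
    using Henstock_Kurzweil_Integration.integral_combine[of 0 a b "\<lambda>x. cmod (h x) + cmod (k x)"] hk[of 0 b] that
    unfolding H_def by (simp add: algebra_simps)
  have Ed: "E b - E a = integral {a..b} (\<lambda>x. h x * (g b - g x) + (f a - f x) * k x)"
    if ab: "0 \<le> a" "a \<le> b" "b \<le> 1" for a b
  proof -
    have cab: "continuous_on {a..b} f" "continuous_on {a..b} g"
      using continuous_on_subset[OF cf] continuous_on_subset[OF cg] ab by auto
    have i1: "h integrable_on {a..b}" "k integrable_on {a..b}" "r integrable_on {a..b}"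
      using sub[OF h] sub[OF k] sub[OF r] ab by (auto simp: absolutely_integrable_on_def)
    have "integral {0..a} r + integral {a..b} r = integral {0..b} r"
      using sub[OF r, of 0 b] ab
      by (intro Henstock_Kurzweil_Integration.integral_combine) (auto simp: absolutely_integrable_on_def)
    then have "E b - E a = f b * g b - f a * g a - integral {a..b} r"
      unfolding E_def by (simp add: algebra_simps)
    also have "f b * g b - f a * g a = (f b - f a) * g b + f a * (g b - g a)"
      by (simp add: algebra_simps)
    also have "\<dots> = integral {a..b} (\<lambda>x. h x * g b + f a * k x)"
      using unit_primitive_integral[OF f ab] unit_primitive_integral[OF g ab] i1
      by (subst integral_add) (auto intro!: integrable_on_mult_left integrable_on_mult_right)
    also have "\<dots> - integral {a..b} r = integral {a..b} (\<lambda>x. (h x * g b + f a * k x) - r x)"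
      using i1 by (intro integral_diff[symmetric])
       (auto intro!: integrable_add integrable_on_mult_left integrable_on_mult_right)
    also have "(\<lambda>x. (h x * g b + f a * k x) - r x) = (\<lambda>x. h x * (g b - g x) + (f a - f x) * k x)"
      unfolding r_def by (auto simp: algebra_simps)
    finally show ?thesis .
  qed
  have main: "cmod (E x - E 0) \<le> e * (H x - H 0)" if x: "x \<in> {0..1}" and e: "e > 0" for x e
  proof -
    have "uniformly_continuous_on {0..1} f" "uniformly_continuous_on {0..1} g"
      using cf cg by (auto intro: compact_uniformly_continuous)
    then obtain d1 d2 where d: "d1 > 0" "d2 > 0"
      "\<And>x y. x \<in> {0..1} \<Longrightarrow> y \<in> {0..1} \<Longrightarrow> \<bar>x - y\<bar> < d1 \<Longrightarrow> cmod (f x - f y) < e"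
      "\<And>x y. x \<in> {0..1} \<Longrightarrow> y \<in> {0..1} \<Longrightarrow> \<bar>x - y\<bar> < d2 \<Longrightarrow> cmod (g x - g y) < e"
      using e unfolding uniformly_continuous_on_def dist_norm real_norm_def by metis
    \<comment> \<open>Subintervals of arbitrary length are reached by bisection.\<close>
    define P where "P a b \<longleftrightarrow> (0 \<le> a \<and> b \<le> 1 \<longrightarrow> cmod (E b - E a) \<le> e * (H b - H a))" for a b
    have "0 \<le> x" using x by simp
    then have "P 0 x"
    proof (induction rule: Bolzano)
      case (trans a b c)
      show ?case unfolding P_def
      proof
        assume ac: "0 \<le> a \<and> c \<le> 1"
        have "cmod (E c - E a) \<le> cmod (E c - E b) + cmod (E b - E a)"
          using norm_triangle_ineq[of "E c - E b" "E b - E a"] by simp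
        also have "\<dots> \<le> e * (H c - H b) + e * (H b - H a)"
          using trans ac unfolding P_def by (intro add_mono) auto
        finally show "cmod (E c - E a) \<le> e * (H c - H a)" by (simp add: algebra_simps)
      qed
    next
      case (local x)
      show ?case
      proof (intro exI[of _ "min d1 d2"] conjI allI impI)
        show "min d1 d2 > 0" using d by simp
        fix a b assume asm: "a \<le> x \<and> x \<le> b \<and> b - a < min d1 d2"
        show "P a b" unfolding P_def
        proof
          assume ab': "0 \<le> a \<and> b \<le> 1"
          then have ab: "0 \<le> a" "a \<le> b" "b \<le> 1" using asm by auto
          have cab: "continuous_on {a..b} f" "continuous_on {a..b} g"
            using continuous_on_subset[OF cf] continuous_on_subset[OF cg] ab by auto
          have "cmod (integral {a..b} (\<lambda>x. h x * (g b - g x) + (f a - f x) * k x))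
             \<le> integral {a..b} (\<lambda>x. e * (cmod (h x) + cmod (k x)))"
          proof (rule integral_norm_bound_integral)
            have "(\<lambda>x. h x * (g b - g x)) absolutely_integrable_on {a..b}"
              "(\<lambda>x. k x * (f a - f x)) absolutely_integrable_on {a..b}"
              using sub[OF h, of a b] sub[OF k, of a b] ab cab
              by (auto intro!: abs_integrable_mult_continuous continuous_intros)
            then show "(\<lambda>x. h x * (g b - g x) + (f a - f x) * k x) integrable_on {a..b}"
              by (intro integrable_add) (simp_all add: absolutely_integrable_on_def mult.commute)
            show "(\<lambda>x. e * (cmod (h x) + cmod (k x))) integrable_on {a..b}"
              using hk ab by (intro integrable_on_mult_right) auto
            fix x assume x: "x \<in> {a..b}"
            have "cmod (g b - g x) \<le> e" "cmod (f a - f x) \<le> e"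
              using d(3)[of a x] d(4)[of b x] x asm ab by auto
            then have "cmod (h x) * cmod (g b - g x) + cmod (f a - f x) * cmod (k x)
                 \<le> cmod (h x) * e + e * cmod (k x)"
              by (intro add_mono mult_left_mono mult_right_mono) auto
            moreover have "cmod (h x * (g b - g x) + (f a - f x) * k x)
                \<le> cmod (h x) * cmod (g b - g x) + cmod (f a - f x) * cmod (k x)"
              by (metis norm_mult norm_triangle_ineq)
            ultimately show "cmod (h x * (g b - g x) + (f a - f x) * k x) \<le> e * (cmod (h x) + cmod (k x))"
              by (simp add: distrib_left mult.commute)
          qed
          also have "\<dots> = e * (H b - H a)" using Hd[OF ab] by simp
          finally show "cmod (E b - E a) \<le> e * (H b - H a)" using Ed[OF ab] by simp
        qed
      qed
    qed
    then show ?thesis using x unfolding P_def by auto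
  qed
  have E: "E x = E 0" if x: "x \<in> {0..1}" for x
  proof -
    have Hx: "0 \<le> H x - H 0" using Hd[of 0 x] x hk[of 0 x] by (simp add: integral_nonneg)
    have "cmod (E x - E 0) \<le> 0 + e" if "e > 0" for e
    proof -
      have "cmod (E x - E 0) \<le> e / (H x - H 0 + 1) * (H x - H 0)"
        using main[OF x, of "e / (H x - H 0 + 1)"] that Hx by simp
      also have "\<dots> \<le> e" using Hx that by (simp add: field_simps)
      finally show ?thesis by simp
    qed
    then have "cmod (E x - E 0) \<le> 0" by (rule field_le_epsilon)
    then show ?thesis by simp
  qed
  have "f x * g x - f 0 * g 0 = integral {0..x} r" if "x \<in> {0..1}" for x
  proof -
    have "f x * g x - integral {0..x} r = f 0 * g 0" using E[OF that] by (simp add: E_def)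
    then show ?thesis by (simp add: diff_eq_eq add.commute)
  qed
  then have "unit_primitive (\<lambda>x. f x * g x) r"
    using r unfolding unit_primitive_def by blast
  then show ?thesis unfolding r_def .
qed

lemma unit_primitive_of_derivative:
  assumes "\<And>x. x \<in> {0..1} \<Longrightarrow> (f has_vector_derivative h x) (at x within {0..1})"
    and "continuous_on {0..1} h"
  shows "unit_primitive f h"
proof -
  have "(h has_integral (f x - f 0)) {0..x}" if x: "x \<in> {0..1}" for x
  proof (rule fundamental_theorem_of_calculus)
    show "0 \<le> x" using x by simp
    fix u assume "u \<in> {0..x}"
    then have "u \<in> {0..1}" "{0..x} \<subseteq> {0..1}" using x by auto
    then show "(f has_vector_derivative h u) (at u within {0..x})"
      using has_vector_derivative_within_subset[OF assms(1)] by blast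
  qed
  then have "f x - f 0 = integral {0..x} h" if "x \<in> {0..1}" for x
    using that integral_unique by metis
  then show ?thesis using assms(2) absolutely_integrable_continuous_real
    unfolding unit_primitive_def by blast
qed

lemma unit_primitive_has_vector_derivative:
  assumes "unit_primitive f h" "continuous_on {0..1} h" "x \<in> {0..1}"
  shows "(f has_vector_derivative h x) (at x within {0..1})"
proof -
  have d: "((\<lambda>u. f 0 + integral {0..u} h) has_vector_derivative (0 + h x)) (at x within {0..1})"
    by (rule has_vector_derivative_add[OF has_vector_derivative_const
          integral_has_vector_derivative[OF assms(2,3)]])
  have e: "f u = f 0 + integral {0..u} h" if "u \<in> {0..1}" for u
    using assms(1) that unfolding unit_primitive_def by (metis add.commute diff_add_cancel)
  have "(f has_vector_derivative (0 + h x)) (at x within {0..1})"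
    by (rule has_vector_derivative_transform[OF assms(3) e d])
  then show ?thesis by simp
qed

section \<open>Solutions of the differential equation and their dependence on the spectral parameter\<close>

definition hill_solution ::
  "(real \<Rightarrow> complex) \<Rightarrow> complex \<Rightarrow> (real \<Rightarrow> complex) \<Rightarrow> (real \<Rightarrow> complex) \<Rightarrow> bool" where
  "hill_solution q z y y1 \<longleftrightarrow> unit_primitive y y1 \<and> unit_primitive y1 (\<lambda>x. (q x - z) * y x)"

lemma hill_expr_imp_unit_primitive:
  assumes "hill_expr S q y f" "S = {0..1} \<or> S = UNIV"
  shows "unit_primitive y (\<lambda>x. vector_derivative y (at x within S))"
    and "unit_primitive (\<lambda>x. vector_derivative y (at x within S)) (\<lambda>x. q x * y x - f x)"
proof -
  obtain y1 where d: "\<And>x. x \<in> S \<Longrightarrow> (y has_vector_derivative y1 x) (at x within S)"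
    and i: "\<And>a b. a \<in> S \<Longrightarrow> b \<in> S \<Longrightarrow> a \<le> b \<Longrightarrow> (\<lambda>x. q x * y x - f x) absolutely_integrable_on {a..b} \<and>
        y1 b - y1 a = integral {a..b} (\<lambda>x. q x * y x - f x)"
    using assms(1) unfolding hill_expr_def by blast
  have S: "{0..1} \<subseteq> S" using assms(2) by auto
  have v: "vector_derivative y (at x within S) = y1 x" if "x \<in> {0..1}" for x
    using assms(2)
  proof
    assume "S = {0..1}"
    with d[of x] that show ?thesis using vector_derivative_within_closed_interval[of 0 1 x] by auto
  next
    assume "S = UNIV"
    then show ?thesis using d[of x] vector_derivative_at by auto
  qed
  have 2: "unit_primitive y1 (\<lambda>x. q x * y x - f x)"
    unfolding unit_primitive_def using i S by (meson atLeastAtMost_iff order.refl subsetD zero_le_one)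
  have "unit_primitive y y1"
  proof (rule unit_primitive_of_derivative)
    show "(y has_vector_derivative y1 x) (at x within {0..1})" if "x \<in> {0..1}" for x
      using d S that by (blast intro: has_vector_derivative_within_subset)
  qed (rule unit_primitive_continuous[OF 2])
  then show "unit_primitive y (\<lambda>x. vector_derivative y (at x within S))"
    by (rule unit_primitive_cong) (simp_all add: v)
  show "unit_primitive (\<lambda>x. vector_derivative y (at x within S)) (\<lambda>x. q x * y x - f x)"
    by (rule unit_primitive_cong[OF 2]) (simp_all add: v)
qed

lemma hill_expr_imp_solution:
  assumes "hill_expr S q y (\<lambda>x. z * y x)" "S = {0..1} \<or> S = UNIV"
  shows "hill_solution q z y (\<lambda>x. vector_derivative y (at x within S))"
  using hill_expr_imp_unit_primitive[OF assms] by (simp add: hill_solution_def left_diff_distrib)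

lemma unit_primitive_imp_hill_expr:
  assumes "unit_primitive y y1" "unit_primitive y1 (\<lambda>x. q x * y x - f x)"
  shows "hill_expr {0..1} q y f"
  unfolding hill_expr_def
  using unit_primitive_has_vector_derivative[OF assms(1) unit_primitive_continuous[OF assms(2)]]
    unit_primitive_abs_integrable[OF assms(2)] unit_primitive_integral[OF assms(2)]
  by (intro exI[of _ y1]) auto

lemma hill_solution_continuous:
  assumes "hill_solution q z y y1"
  shows "continuous_on {0..1} y" "continuous_on {0..1} y1"
  using assms unit_primitive_continuous unfolding hill_solution_def by blast+

text \<open>The potential cancels from \<open>(y u' - y' u)' = y u'' - y'' u\<close>; only the difference of the spectral
  parameters is left.\<close>

lemma hill_solution_green:
  assumes "hill_solution q w y y1" "hill_solution q z u u1"
  shows "unit_primitive (\<lambda>x. y x * u1 x - y1 x * u x) (\<lambda>x. (w - z) * (y x * u x))"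
proof -
  have y: "unit_primitive y y1" "unit_primitive y1 (\<lambda>x. (q x - w) * y x)"
    and u: "unit_primitive u u1" "unit_primitive u1 (\<lambda>x. (q x - z) * u x)"
    using assms by (auto simp: hill_solution_def)
  show ?thesis
    by (rule unit_primitive_cong[OF unit_primitive_diff[OF
          unit_primitive_mult[OF y(1) u(2)] unit_primitive_mult[OF y(2) u(1)]]])
      (simp_all add: algebra_simps)
qed

lemma hill_solution_green_eq:
  assumes "hill_solution q w y y1" "hill_solution q z u u1" "x \<in> {0..1}"
  shows "y x * u1 x - y1 x * u x = y 0 * u1 0 - y1 0 * u 0 + (w - z) * integral {0..x} (\<lambda>s. y s * u s)"
proof -
  have "(y x * u1 x - y1 x * u x) - (y 0 * u1 0 - y1 0 * u 0)
      = integral {0..x} (\<lambda>s. (w - z) * (y s * u s))"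
    using hill_solution_green[OF assms(1,2)] assms(3) unfolding unit_primitive_def by blast
  then show ?thesis unfolding integral_mult_right by (simp only: diff_eq_eq add.commute)
qed

lemma hill_wronskian_constant:
  assumes "hill_solution q z y y1" "hill_solution q z u u1" "x \<in> {0..1}"
  shows "y x * u1 x - y1 x * u x = y 0 * u1 0 - y1 0 * u 0"
  using hill_solution_green_eq[OF assms] by simp

text \<open>Here \<open>\<theta>1\<close> and \<open>\<phi>1\<close> are the derivatives in the space variable. They are parameters because
  \<open>hill_solution\<close> carries the derivative along with the solution.\<close>

locale hill_system =
  fixes q :: "real \<Rightarrow> complex" and \<theta> \<theta>1 \<phi> \<phi>1 :: "real \<Rightarrow> complex \<Rightarrow> complex"
  assumes sol_\<theta>: "hill_solution q z (\<lambda>x. \<theta> x z) (\<lambda>x. \<theta>1 x z)"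
    and sol_\<phi>: "hill_solution q z (\<lambda>x. \<phi> x z) (\<lambda>x. \<phi>1 x z)"
    and init: "\<theta> 0 z = 1" "\<theta>1 0 z = 0" "\<phi> 0 z = 0" "\<phi>1 0 z = 1"
begin

lemma wronskian_eq_1: "x \<in> {0..1} \<Longrightarrow> \<theta> x z * \<phi>1 x z - \<theta>1 x z * \<phi> x z = 1"
  using hill_wronskian_constant[OF sol_\<theta> sol_\<phi>] by (simp add: init)

text \<open>By Cramer's rule a function is a combination of \<open>\<theta>\<close> and \<open>\<phi>\<close> whose coefficients are its Wronskians
  with \<open>\<phi>\<close> and \<open>\<theta>\<close>; Green's identity evaluates these. For \<open>w = z\<close> this is uniqueness of solutions, and
  for \<open>w\<close> close to \<open>z\<close> it controls the dependence on the spectral parameter.\<close>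

lemma solution_perturbation:
  fixes z :: complex
  assumes y: "hill_solution q w y y1" and x: "x \<in> {0..1}"
  defines "A \<equiv> y 0 + (w - z) * integral {0..x} (\<lambda>s. y s * \<phi> s z)"
    and "B \<equiv> y1 0 - (w - z) * integral {0..x} (\<lambda>s. y s * \<theta> s z)"
  shows "y x = A * \<theta> x z + B * \<phi> x z" "y1 x = A * \<theta>1 x z + B * \<phi>1 x z"
proof -
  have A: "y x * \<phi>1 x z - y1 x * \<phi> x z = A"
    using hill_solution_green_eq[OF y sol_\<phi> x] by (simp add: A_def init)
  have B: "y1 x * \<theta> x z - y x * \<theta>1 x z = B"
    using hill_solution_green_eq[OF y sol_\<theta> x, of z] by (simp add: B_def init algebra_simps)
  have "y x * (\<theta> x z * \<phi>1 x z - \<theta>1 x z * \<phi> x z) = A * \<theta> x z + B * \<phi> x z"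
    "y1 x * (\<theta> x z * \<phi>1 x z - \<theta>1 x z * \<phi> x z) = A * \<theta>1 x z + B * \<phi>1 x z"
    unfolding A[symmetric] B[symmetric] by algebra+
  then show "y x = A * \<theta> x z + B * \<phi> x z" "y1 x = A * \<theta>1 x z + B * \<phi>1 x z"
    using wronskian_eq_1[OF x] by auto
qed

lemma solution_expand:
  assumes "hill_solution q z y y1" "x \<in> {0..1}"
  shows "y x = y 0 * \<theta> x z + y1 0 * \<phi> x z" "y1 x = y 0 * \<theta>1 x z + y1 0 * \<phi>1 x z"
  using solution_perturbation[OF assms, of z] by auto

lemma continuous_\<theta>\<phi>: "continuous_on {0..1} (\<lambda>x. \<theta> x z)" "continuous_on {0..1} (\<lambda>x. \<phi> x z)"
  using hill_solution_continuous(1)[OF sol_\<theta>] hill_solution_continuous(1)[OF sol_\<phi>] .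

text \<open>The perturbation formula is an integral equation for \<open>Y x w\<close> with the small factor \<open>w - z\<close>. Evaluated
  where \<open>|Y x w|\<close> is maximal, it bounds this maximum by \<open>2 B\<close> as soon as the factor is at most
  \<open>1 / (2 C)\<close>, where \<open>B\<close> bounds \<open>|Y x z|\<close> and \<open>C\<close> the kernel; a second use gives a Lipschitz bound for the difference.\<close>

lemma solution_uniform_limit:
  assumes Y: "\<And>w. hill_solution q w (\<lambda>x. Y x w) (\<lambda>x. Y1 x w)" "\<And>w. Y 0 w = a" "\<And>w. Y1 0 w = b"
  shows "uniform_limit {0..1} (\<lambda>w x. Y x w) (\<lambda>x. Y x z) (at z)"
proof -
  have cY: "continuous_on {0..1} (\<lambda>x. Y x w)" for w
    using hill_solution_continuous(1)[OF Y(1)] .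
  have bd: "\<exists>C>0. \<forall>x\<in>{0..1}. cmod (f x) \<le> C" if "continuous_on {0..1::real} f" for f :: "real \<Rightarrow> complex"
    using compact_imp_bounded[OF compact_continuous_image[OF that]] unfolding bounded_pos by auto
  obtain C1 where C1: "C1 > 0" "\<And>x. x \<in> {0..1} \<Longrightarrow> cmod (\<theta> x z) \<le> C1" using bd[OF continuous_\<theta>\<phi>(1)] by blast
  obtain C2 where C2: "C2 > 0" "\<And>x. x \<in> {0..1} \<Longrightarrow> cmod (\<phi> x z) \<le> C2" using bd[OF continuous_\<theta>\<phi>(2)] by blast
  obtain B where B: "B > 0" "\<And>x. x \<in> {0..1} \<Longrightarrow> cmod (Y x z) \<le> B" using bd[OF cY] by blast
  define C where "C = 2 * C1 * C2"
  have C: "C > 0" using C1 C2 by (simp add: C_def)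
  have est: "cmod (Y x w - Y x z) \<le> cmod (w - z) * (C * M)"
    if x: "x \<in> {0..1}" and M: "\<And>x. x \<in> {0..1} \<Longrightarrow> cmod (Y x w) \<le> M" for x w M
  proof -
    have M0: "0 \<le> M" using M[OF x] norm_ge_zero order_trans by blast
    have diff: "Y x w - Y x z = (w - z) * (integral {0..x} (\<lambda>s. Y s w * \<phi> s z) * \<theta> x z
                                   - integral {0..x} (\<lambda>s. Y s w * \<theta> s z) * \<phi> x z)"
      using solution_perturbation(1)[OF Y(1)[of w] x, of z] solution_perturbation(1)[OF Y(1)[of z] x, of z]
      by (simp add: Y(2,3) algebra_simps)
    have "cmod (integral {0..x} (\<lambda>s. Y s w * g s)) \<le> M * G"
      if "continuous_on {0..1} g" "G > 0" "\<And>x. x \<in> {0..1} \<Longrightarrow> cmod (g x) \<le> G" for g G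
    proof -
      have "cmod (integral {0..x} (\<lambda>s. Y s w * g s)) \<le> M * G * (x - 0)"
      proof (rule integral_bound)
        show "continuous_on {0..x} (\<lambda>s. Y s w * g s)"
          using x by (intro continuous_intros continuous_on_subset[OF cY] continuous_on_subset[OF that(1)]) auto
        show "\<And>t. t \<in> {0..x} \<Longrightarrow> cmod (Y t w * g t) \<le> M * G"
          unfolding norm_mult using x that M M0 by (intro mult_mono) auto
      qed (use x in auto)
      also have "\<dots> \<le> M * G" using x M0 that by (simp add: mult_left_le)
      finally show ?thesis .
    qed
    note I = this[OF continuous_\<theta>\<phi>(1) C1(1,2)] this[OF continuous_\<theta>\<phi>(2) C2(1,2)]
    have "cmod (integral {0..x} (\<lambda>s. Y s w * \<phi> s z) * \<theta> x z
                                   - integral {0..x} (\<lambda>s. Y s w * \<theta> s z) * \<phi> x z) \<le> M * C2 * C1 + M * C1 * C2"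
      by (intro order_trans[OF norm_triangle_ineq4] add_mono; unfold norm_mult; intro mult_mono I C1 C2)
        (use x M0 C1 C2 in auto)
    also have "\<dots> = C * M" by (simp add: C_def)
    finally show ?thesis
      unfolding diff norm_mult by (intro mult_left_mono) auto
  qed
  have lip: "cmod (Y x w - Y x z) \<le> cmod (w - z) * (2 * C * B)"
    if x: "x \<in> {0..1}" and w: "cmod (w - z) \<le> 1 / (2 * C)" for x w
  proof -
    have "continuous_on {0..1} (\<lambda>x. cmod (Y x w))" using cY by (intro continuous_intros)
    then obtain m where m: "m \<in> {0..1}" "\<And>x. x \<in> {0..1} \<Longrightarrow> cmod (Y x w) \<le> cmod (Y m w)"
      using continuous_attains_sup[of "{0..1::real}" "\<lambda>x. cmod (Y x w)"] by auto
    have "cmod (Y m w) \<le> cmod (Y m z) + cmod (Y m w - Y m z)"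
      by (metis add_diff_cancel_left' diff_add_cancel norm_triangle_ineq)
    also have "\<dots> \<le> B + cmod (w - z) * C * cmod (Y m w)"
      using B(2)[OF m(1)] est[OF m(1) m(2)] by simp
    also have "\<dots> \<le> B + 1 / 2 * cmod (Y m w)"
      using w C by (intro add_left_mono mult_right_mono) (auto simp: field_simps)
    finally have "cmod (Y m w) \<le> 2 * B" by simp
    then have "cmod (w - z) * (C * cmod (Y m w)) \<le> cmod (w - z) * (C * (2 * B))"
      using C by (intro mult_left_mono) auto
    then show ?thesis using est[OF x m(2)] by (simp add: mult_ac)
  qed
  show ?thesis
  proof (rule uniform_limitI)
    fix e :: real assume e: "e > 0"
    define d where "d = min (1 / (2 * C)) (e / (4 * C * B))"
    have d: "d > 0" using C B e by (simp add: d_def)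
    have "\<forall>\<^sub>F w in at z. dist w z < d" using d by (auto simp: eventually_at)
    then show "\<forall>\<^sub>F w in at z. \<forall>x\<in>{0..1}. dist (Y x w) (Y x z) < e"
    proof eventually_elim
      case (elim w)
      show ?case
      proof
        fix x :: real assume x: "x \<in> {0..1}"
        have w: "cmod (w - z) \<le> 1 / (2 * C)" "cmod (w - z) \<le> e / (4 * C * B)"
          using elim by (auto simp: dist_norm d_def)
        have "cmod (Y x w - Y x z) \<le> e / (4 * C * B) * (2 * C * B)"
          using lip[OF x w(1)] w(2) C B by (meson less_imp_le mult_pos_pos mult_right_mono order_trans zero_less_numeral)
        also have "\<dots> < e" using C B e by (simp add: field_simps)
        finally show "dist (Y x w) (Y x z) < e" by (simp add: dist_norm)
      qed
    qed
  qed
qed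

lemma uniform_limit_\<theta>: "uniform_limit {0..1} (\<lambda>w x. \<theta> x w) (\<lambda>x. \<theta> x z) (at z)"
  and uniform_limit_\<phi>: "uniform_limit {0..1} (\<lambda>w x. \<phi> x w) (\<lambda>x. \<phi> x z) (at z)"
  using solution_uniform_limit[OF sol_\<theta>] solution_uniform_limit[OF sol_\<phi>] by (auto simp: init)

lemma integral_mult_tendsto:
  fixes g :: "real \<Rightarrow> complex"
  assumes u: "uniform_limit {0..1} (\<lambda>w x. Y x w) y F" and c: "\<And>w. continuous_on {0..1} (\<lambda>x. Y x w)"
    and g: "continuous_on {0..1} g" and F: "F \<noteq> bot"
  shows "((\<lambda>w. integral {0..1} (\<lambda>x. Y x w * g x)) \<longlongrightarrow> integral {0..1} (\<lambda>x. y x * g x)) F"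
proof -
  have cy: "continuous_on {0..1} y"
    by (rule uniform_limit_theorem[OF _ u F]) (simp add: c)
  have "uniform_limit {0..1} (\<lambda>w x. Y x w * g x) (\<lambda>x. y x * g x) F"
    using cy g
    by (intro uniform_lim_mult u uniform_limit_const compact_imp_bounded compact_continuous_image) auto
  then obtain I J where IJ: "\<And>w. ((\<lambda>x. Y x w * g x) has_integral I w) {0..1}"
    "((\<lambda>x. y x * g x) has_integral J) {0..1}" "(I \<longlongrightarrow> J) F"
    by (rule uniform_limit_integral[OF _ _ F]) (use c g in \<open>auto intro!: continuous_intros\<close>)
  from IJ(3) show ?thesis unfolding integral_unique[OF IJ(1)] integral_unique[OF IJ(2)] .
qed

definition discriminant :: "complex \<Rightarrow> complex" where "discriminant z = \<phi>1 1 z + \<theta> 1 z"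

definition discriminant_deriv :: "complex \<Rightarrow> complex" where
  "discriminant_deriv z = (\<theta> 1 z - \<phi>1 1 z) * integral {0..1} (\<lambda>x. \<theta> x z * \<phi> x z)
     - \<phi> 1 z * integral {0..1} (\<lambda>x. \<theta> x z * \<theta> x z) + \<theta>1 1 z * integral {0..1} (\<lambda>x. \<phi> x z * \<phi> x z)"

lemma tendsto_integrals:
  assumes "continuous_on {0..1} g"
  shows "((\<lambda>w. integral {0..1} (\<lambda>x. \<theta> x w * g x)) \<longlongrightarrow> integral {0..1} (\<lambda>x. \<theta> x z * g x)) (at z)"
    "((\<lambda>w. integral {0..1} (\<lambda>x. \<phi> x w * g x)) \<longlongrightarrow> integral {0..1} (\<lambda>x. \<phi> x z * g x)) (at z)"
  by (rule integral_mult_tendsto[OF uniform_limit_\<theta> continuous_\<theta>\<phi>(1) assms], simp)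
    (rule integral_mult_tendsto[OF uniform_limit_\<phi> continuous_\<theta>\<phi>(2) assms], simp)

text \<open>The matrix with rows \<open>(\<theta>, \<phi>)\<close> and \<open>(\<theta>1, \<phi>1)\<close> at \<open>x = 1\<close> is the monodromy matrix; here its
  difference quotient becomes explicit.\<close>

lemma monodromy_perturbation:
  "\<theta> 1 w = (1 + (w - z) * integral {0..1} (\<lambda>s. \<theta> s w * \<phi> s z)) * \<theta> 1 z
            - (w - z) * integral {0..1} (\<lambda>s. \<theta> s w * \<theta> s z) * \<phi> 1 z"
  "\<theta>1 1 w = (1 + (w - z) * integral {0..1} (\<lambda>s. \<theta> s w * \<phi> s z)) * \<theta>1 1 z
            - (w - z) * integral {0..1} (\<lambda>s. \<theta> s w * \<theta> s z) * \<phi>1 1 z"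
  "\<phi> 1 w = (w - z) * integral {0..1} (\<lambda>s. \<phi> s w * \<phi> s z) * \<theta> 1 z
            + (1 - (w - z) * integral {0..1} (\<lambda>s. \<phi> s w * \<theta> s z)) * \<phi> 1 z"
  "\<phi>1 1 w = (w - z) * integral {0..1} (\<lambda>s. \<phi> s w * \<phi> s z) * \<theta>1 1 z
            + (1 - (w - z) * integral {0..1} (\<lambda>s. \<phi> s w * \<theta> s z)) * \<phi>1 1 z"
  using solution_perturbation[OF sol_\<theta>[of w], of 1 z] solution_perturbation[OF sol_\<phi>[of w], of 1 z]
  by (simp_all add: init)

lemma monodromy_isCont:
  "isCont (\<theta> 1) z" "isCont (\<theta>1 1) z" "isCont (\<phi> 1) z" "isCont (\<phi>1 1) z"
proof -
  note [tendsto_intros] = tendsto_integrals[OF continuous_\<theta>\<phi>(1)] tendsto_integrals[OF continuous_\<theta>\<phi>(2)]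
  have t: "((\<lambda>w. (1 + (w - z) * integral {0..1} (\<lambda>s. \<theta> s w * \<phi> s z)) * a
            - (w - z) * integral {0..1} (\<lambda>s. \<theta> s w * \<theta> s z) * b) \<longlongrightarrow>
         (1 + (z - z) * integral {0..1} (\<lambda>s. \<theta> s z * \<phi> s z)) * a
            - (z - z) * integral {0..1} (\<lambda>s. \<theta> s z * \<theta> s z) * b) (at z)"
     "((\<lambda>w. (w - z) * integral {0..1} (\<lambda>s. \<phi> s w * \<phi> s z) * a
            + (1 - (w - z) * integral {0..1} (\<lambda>s. \<phi> s w * \<theta> s z)) * b) \<longlongrightarrow>
        (z - z) * integral {0..1} (\<lambda>s. \<phi> s z * \<phi> s z) * a
            + (1 - (z - z) * integral {0..1} (\<lambda>s. \<phi> s z * \<theta> s z)) * b) (at z)" for a b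
    by (intro tendsto_intros)+
  show "isCont (\<theta> 1) z"
    using t(1)[of "\<theta> 1 z" "\<phi> 1 z"] unfolding isCont_def monodromy_perturbation(1)[of _ z, symmetric] .
  show "isCont (\<theta>1 1) z"
    using t(1)[of "\<theta>1 1 z" "\<phi>1 1 z"] unfolding isCont_def monodromy_perturbation(2)[of _ z, symmetric] .
  show "isCont (\<phi> 1) z"
    using t(2)[of "\<theta> 1 z" "\<phi> 1 z"] unfolding isCont_def monodromy_perturbation(3)[of _ z, symmetric] .
  show "isCont (\<phi>1 1) z"
    using t(2)[of "\<theta>1 1 z" "\<phi>1 1 z"] unfolding isCont_def monodromy_perturbation(4)[of _ z, symmetric] .
qed

lemma discriminant_has_derivative: "(discriminant has_field_derivative discriminant_deriv z) (at z)"
proof -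
  note [tendsto_intros] = tendsto_integrals[OF continuous_\<theta>\<phi>(1)] tendsto_integrals[OF continuous_\<theta>\<phi>(2)]
  let ?Q = "\<lambda>w. \<theta> 1 z * integral {0..1} (\<lambda>x. \<theta> x w * \<phi> x z) - \<phi> 1 z * integral {0..1} (\<lambda>x. \<theta> x w * \<theta> x z)
     + \<theta>1 1 z * integral {0..1} (\<lambda>x. \<phi> x w * \<phi> x z) - \<phi>1 1 z * integral {0..1} (\<lambda>x. \<phi> x w * \<theta> x z)"
  have alg: "d * C * t1 + (1 - d * D) * p1 + ((1 + d * A) * t - d * B * p) - (p1 + t)
      = d * (t * A - p * B + t1 * C - p1 * D)" for A B C D d p p1 t t1 :: complex
    by (simp add: algebra_simps)
  have "discriminant w - discriminant z = (w - z) * ?Q w" for w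
    unfolding discriminant_def monodromy_perturbation(1,4)[of w z] by (rule alg)
  then have "(discriminant w - discriminant z) / (w - z) = ?Q w" if "w \<noteq> z" for w
    using that by simp
  then have e: "\<forall>\<^sub>F w in at z. ?Q w = (discriminant w - discriminant z) / (w - z)"
    by (auto simp: eventually_at_filter)
  have "(?Q \<longlongrightarrow> ?Q z) (at z)" by (intro tendsto_intros)
  from Lim_transform_eventually[OF this e]
  have "(discriminant has_field_derivative ?Q z) (at z)" by (simp only: has_field_derivative_iff)
  moreover have "?Q z = discriminant_deriv z"
    unfolding discriminant_deriv_def by (simp add: left_diff_distrib mult.commute[of "\<phi> _ z" "\<theta> _ z"])
  ultimately show ?thesis by simp
qed

end

section \<open>Square integrable functions on the unit interval\<close>

lemma integral_unit_interval_eq: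
  fixes f :: "real \<Rightarrow> complex"
  assumes "continuous_on {0..1} f"
  shows "integral\<^sup>L (lebesgue_on {0..1}) f = integral {0..1} f"
proof (rule lebesgue_integral_eq_integral)
  show "integrable (lebesgue_on {0..1}) f"
    using assms by (intro absolutely_integrable_imp_integrable absolutely_integrable_continuous_real) auto
qed auto

lemma continuous_imp_L2_unit:
  assumes "continuous_on {0..1} f"
  shows "f \<in> L2_unit"
proof -
  have "(\<lambda>x. (cmod (f x))\<^sup>2) absolutely_integrable_on {0..1}"
    using assms by (intro absolutely_integrable_continuous_real continuous_intros)
  then show ?thesis
    using assms unfolding L2_unit_def
    by (auto intro!: absolutely_integrable_imp_integrable continuous_imp_measurable_on_sets_lebesgue)
qed

lemma L2_unit_mult_integrable:
  assumes "f \<in> L2_unit" "g \<in> L2_unit"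
  shows "integrable (lebesgue_on {0..1}) (\<lambda>x. f x * g x)"
proof (rule Bochner_Integration.integrable_bound)
  show "integrable (lebesgue_on {0..1}) (\<lambda>x. (cmod (f x))\<^sup>2 + (cmod (g x))\<^sup>2)"
    using assms unfolding L2_unit_def by auto
  show "(\<lambda>x. f x * g x) \<in> borel_measurable (lebesgue_on {0..1})"
    using assms unfolding L2_unit_def by auto
  have "cmod (a * b) \<le> (cmod a)\<^sup>2 + (cmod b)\<^sup>2" for a b
  proof -
    have "2 * (cmod a * cmod b) \<le> (cmod a)\<^sup>2 + (cmod b)\<^sup>2"
      using zero_le_power2[of "cmod a - cmod b"] by (simp add: power2_diff)
    moreover have "0 \<le> cmod a * cmod b" by simp
    ultimately show ?thesis unfolding norm_mult by linarith
  qed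
  then show "AE x in lebesgue_on {0..1}. norm (f x * g x) \<le> norm ((cmod (f x))\<^sup>2 + (cmod (g x))\<^sup>2)"
    by (auto simp: abs_of_nonneg)
qed

lemma L2_unit_cnj:
  assumes "f \<in> L2_unit" shows "(\<lambda>x. cnj (f x)) \<in> L2_unit"
proof -
  have "cnj \<in> borel_measurable borel"
    by (intro borel_measurable_continuous_onI continuous_intros)
  then show ?thesis using assms measurable_compose[of f _ borel cnj borel] unfolding L2_unit_def by auto
qed

lemma L2_unit_cmult: "f \<in> L2_unit \<Longrightarrow> (\<lambda>x. c * f x) \<in> L2_unit"
  unfolding L2_unit_def by (auto simp: norm_mult power_mult_distrib)

lemma L2_unit_add:
  assumes "f \<in> L2_unit" "g \<in> L2_unit"
  shows "(\<lambda>x. f x + g x) \<in> L2_unit"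
proof -
  have "integrable (lebesgue_on {0..1}) (\<lambda>x. (cmod (f x + g x))\<^sup>2)"
  proof (rule Bochner_Integration.integrable_bound)
    show "integrable (lebesgue_on {0..1}) (\<lambda>x. 2 * (cmod (f x))\<^sup>2 + 2 * (cmod (g x))\<^sup>2)"
      using assms unfolding L2_unit_def by auto
    show "(\<lambda>x. (cmod (f x + g x))\<^sup>2) \<in> borel_measurable (lebesgue_on {0..1})"
      using assms unfolding L2_unit_def by auto
    have "(cmod (a + b))\<^sup>2 \<le> 2 * (cmod a)\<^sup>2 + 2 * (cmod b)\<^sup>2" for a b
    proof -
      have "(cmod (a + b))\<^sup>2 \<le> (cmod a + cmod b)\<^sup>2"
        by (intro power_mono norm_triangle_ineq) auto
      also have "\<dots> \<le> 2 * (cmod a)\<^sup>2 + 2 * (cmod b)\<^sup>2"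
        using zero_le_power2[of "cmod a - cmod b"] by (simp add: power2_diff power2_sum)
      finally show ?thesis .
    qed
    then show "AE x in lebesgue_on {0..1}. norm ((cmod (f x + g x))\<^sup>2) \<le> norm (2 * (cmod (f x))\<^sup>2 + 2 * (cmod (g x))\<^sup>2)"
      by auto
  qed
  then show ?thesis using assms unfolding L2_unit_def by auto
qed

lemma L2_unit_diff:
  assumes "f \<in> L2_unit" "g \<in> L2_unit"
  shows "(\<lambda>x. f x - g x) \<in> L2_unit"
  using L2_unit_add[OF assms(1) L2_unit_cmult[OF assms(2), of "-1"]] by simp

lemma L2_unit_abs_integrable:
  assumes "f \<in> L2_unit"
  shows "f absolutely_integrable_on {0..1}"
proof -
  have "(\<lambda>x. 1) \<in> L2_unit" by (intro continuous_imp_L2_unit continuous_intros)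
  from L2_unit_mult_integrable[OF assms this]
  have "integrable (lebesgue_on {0..1}) f" by simp
  then show ?thesis by (simp add: set_integrable_def integrable_restrict_space)
qed

lemma L2_norm_cong: "(\<And>x. x \<in> {0..1} \<Longrightarrow> f x = g x) \<Longrightarrow> L2_norm f = L2_norm g"
  unfolding L2_norm_def by (intro arg_cong[of _ _ sqrt] Bochner_Integration.integral_cong) auto

lemma L2_norm_cmult: "L2_norm (\<lambda>x. c * f x) = cmod c * L2_norm f"
  unfolding L2_norm_def by (simp add: norm_mult power_mult_distrib real_sqrt_mult)

lemma L2_inner_self: "L2_inner f f = of_real ((L2_norm f)\<^sup>2)"
proof -
  have "L2_inner f f = integral\<^sup>L (lebesgue_on {0..1}) (\<lambda>x. of_real ((cmod (f x))\<^sup>2))"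
    unfolding L2_inner_def by (simp add: complex_norm_square[symmetric])
  also have "\<dots> = of_real (integral\<^sup>L (lebesgue_on {0..1}) (\<lambda>x. (cmod (f x))\<^sup>2))"
    by (rule integral_complex_of_real)
  also have "integral\<^sup>L (lebesgue_on {0..1}) (\<lambda>x. (cmod (f x))\<^sup>2) = (L2_norm f)\<^sup>2"
    unfolding L2_norm_def by simp
  finally show ?thesis .
qed

lemma L2_inner_self_eq_0_imp_AE:
  assumes "f \<in> L2_unit" "L2_inner f f = 0"
  shows "AE x in lebesgue_on {0..1}. f x = 0"
proof -
  have "L2_norm f = 0" using assms(2) by (simp add: L2_inner_self)
  then have "integral\<^sup>L (lebesgue_on {0..1}) (\<lambda>x. (cmod (f x))\<^sup>2) = 0"
    by (simp add: L2_norm_def)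
  then have "AE x in lebesgue_on {0..1}. (cmod (f x))\<^sup>2 = 0"
    using assms(1) unfolding L2_unit_def
    by (subst (asm) integral_nonneg_eq_0_iff_AE) auto
  then show ?thesis by auto
qed

section \<open>Floquet solutions and the adjoint eigenfunction\<close>

lemma hill_op_eigen_solution:
  assumes "(y, \<lambda>x. z * y x) \<in> hill_op q t"
  obtains y1 where "hill_solution q z y y1" "y 1 = cis t * y 0" "y1 1 = cis t * y1 0"
  using assms hill_expr_imp_solution[of "{0..1}" q y z] unfolding hill_op_def by auto

context hill_system begin

lemma monodromy_eigenvector:
  assumes "hill_solution q z u u1" "u 1 = \<rho> * u 0" "u1 1 = \<rho> * u1 0"
  shows "u 0 * \<theta> 1 z + u1 0 * \<phi> 1 z = \<rho> * u 0" "u 0 * \<theta>1 1 z + u1 0 * \<phi>1 1 z = \<rho> * u1 0"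
  using solution_expand[OF assms(1), of 1] assms(2,3) by auto

lemma solution_initial_nonzero:
  assumes "hill_solution q z u u1" "L2_norm u \<noteq> 0"
  shows "u 0 \<noteq> 0 \<or> u1 0 \<noteq> 0"
proof (rule ccontr)
  assume "\<not> ?thesis"
  then have "u x = 0 * u x" if "x \<in> {0..1}" for x
    using solution_expand(1)[OF assms(1) that] by simp
  then have "L2_norm u = L2_norm (\<lambda>x. 0 * u x)" by (rule L2_norm_cong)
  then show False using assms(2) by (simp add: L2_norm_cmult[of 0, simplified])
qed

end

text \<open>Two normalized solutions with distinct Floquet multipliers. For real \<open>t\<close> with \<open>sin t \<noteq> 0\<close>
  they arise from eigenfunctions of the operators with parameters \<open>t\<close> and \<open>- t\<close>, with \<open>\<rho> = cis t\<close> and \<open>\<sigma> = cis (- t)\<close>.\<close>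

locale floquet_pair = hill_system +
  fixes z \<rho> \<sigma> :: complex and u u1 v v1 :: "real \<Rightarrow> complex"
  assumes u: "hill_solution q z u u1" "u 1 = \<rho> * u 0" "u1 1 = \<rho> * u1 0" "L2_norm u = 1"
    and v: "hill_solution q z v v1" "v 1 = \<sigma> * v 0" "v1 1 = \<sigma> * v1 0" "L2_norm v = 1"
    and distinct: "\<rho> \<noteq> \<sigma>"
begin

definition W :: complex where "W = u 0 * v1 0 - u1 0 * v 0"

text \<open>The monodromy matrix has eigenvectors \<open>(u 0, u1 0)\<close> and \<open>(v 0, v1 0)\<close>; solving the eigenvector
  equations for its entries by Cramer's rule expresses it through \<open>u\<close> and \<open>v\<close>.\<close>

lemma monodromy_times_W:
  "\<phi> 1 z * W = (\<sigma> - \<rho>) * (u 0 * v 0)"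
  "\<theta>1 1 z * W = (\<rho> - \<sigma>) * (u1 0 * v1 0)"
  "\<theta> 1 z * W = \<rho> * (u 0 * v1 0) - \<sigma> * (u1 0 * v 0)"
  "\<phi>1 1 z * W = \<sigma> * (u 0 * v1 0) - \<rho> * (u1 0 * v 0)"
  using monodromy_eigenvector[OF u(1-3)] monodromy_eigenvector[OF v(1-3)] unfolding W_def by algebra+

lemma W_nonzero: "W \<noteq> 0"
proof
  assume W: "W = 0"
  have "\<rho> * (u 0 * v1 0) = \<sigma> * (u1 0 * v 0)" using monodromy_times_W(3) W by simp
  moreover have "u 0 * v1 0 = u1 0 * v 0" using W by (simp add: W_def)
  ultimately have "u 0 * v1 0 = 0" "u1 0 * v 0 = 0" "u 0 * v 0 = 0" "u1 0 * v1 0 = 0"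
    using monodromy_times_W(1,2) W distinct by auto
  moreover have "u 0 \<noteq> 0 \<or> u1 0 \<noteq> 0" "v 0 \<noteq> 0 \<or> v1 0 \<noteq> 0"
    using solution_initial_nonzero[OF u(1)] solution_initial_nonzero[OF v(1)] u(4) v(4) by auto
  ultimately show False by auto
qed

text \<open>Up to the factor \<open>(\<rho> - \<sigma>) / W\<close> the integrand of \<open>discriminant_deriv\<close> is the product \<open>u v\<close>, written
  in terms of \<open>\<theta>\<close> and \<open>\<phi>\<close>.\<close>

lemma integral_uv: "discriminant_deriv z * W = (\<rho> - \<sigma>) * integral {0..1} (\<lambda>x. u x * v x)"
proof -
  note [continuous_intros] = continuous_\<theta>\<phi>
  have i: "(\<lambda>x. \<theta> x z * \<theta> x z) integrable_on {0..1}" "(\<lambda>x. \<theta> x z * \<phi> x z) integrable_on {0..1}"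
    "(\<lambda>x. \<phi> x z * \<phi> x z) integrable_on {0..1}"
    by (intro integrable_continuous_interval continuous_intros)+
  have "integral {0..1} (\<lambda>x. u x * v x) = integral {0..1} (\<lambda>x. u 0 * v 0 * (\<theta> x z * \<theta> x z)
     + (u 0 * v1 0 + u1 0 * v 0) * (\<theta> x z * \<phi> x z) + u1 0 * v1 0 * (\<phi> x z * \<phi> x z))"
  proof (rule integral_cong)
    fix x :: real assume x: "x \<in> {0..1}"
    show "u x * v x = u 0 * v 0 * (\<theta> x z * \<theta> x z)
     + (u 0 * v1 0 + u1 0 * v 0) * (\<theta> x z * \<phi> x z) + u1 0 * v1 0 * (\<phi> x z * \<phi> x z)"
      using solution_expand(1)[OF u(1) x] solution_expand(1)[OF v(1) x] by algebra
  qed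
  also have "\<dots> = u 0 * v 0 * integral {0..1} (\<lambda>x. \<theta> x z * \<theta> x z)
     + (u 0 * v1 0 + u1 0 * v 0) * integral {0..1} (\<lambda>x. \<theta> x z * \<phi> x z)
     + u1 0 * v1 0 * integral {0..1} (\<lambda>x. \<phi> x z * \<phi> x z)"
    using i by (subst integral_add integral_add; (intro integrable_add integrable_on_mult_right)?; simp)+
  finally show ?thesis
    using monodromy_times_W unfolding discriminant_deriv_def by algebra
qed

text \<open>Variation of constants: \<open>y = A u + B v\<close> with \<open>A' = f v / W\<close> and \<open>B' = - f u / W\<close>. The boundary
  condition with multiplier \<open>\<rho>\<close> asks for \<open>A 1 = A 0\<close>, which is the orthogonality assumption, and for
  \<open>\<sigma> B 1 = \<rho> B 0\<close>, which the free constant in \<open>B\<close> achieves because \<open>\<rho> \<noteq> \<sigma>\<close>.\<close>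

lemma range_contains_orthogonal:
  assumes f: "f \<in> L2_unit" and orth: "integral {0..1} (\<lambda>x. f x * v x) = 0"
  obtains y y1 where "unit_primitive y y1" "unit_primitive y1 (\<lambda>x. q x * y x - (z * y x + f x))"
    "y 1 = \<rho> * y 0" "y1 1 = \<rho> * y1 0"
proof -
  have f1: "f absolutely_integrable_on {0..1}" using f by (rule L2_unit_abs_integrable)
  have fu: "(\<lambda>x. f x * u x) absolutely_integrable_on {0..1}" and fv: "(\<lambda>x. f x * v x) absolutely_integrable_on {0..1}"
    using abs_integrable_mult_continuous[OF f1 hill_solution_continuous(1)[OF u(1)]]
      abs_integrable_mult_continuous[OF f1 hill_solution_continuous(1)[OF v(1)]] .
  define b where "b = - integral {0..1} (\<lambda>x. f x * u x) / W"
  define A where "A x = inverse W * integral {0..x} (\<lambda>s. f s * v s)" for x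
  define B where "B x = \<sigma> * b / (\<rho> - \<sigma>) - inverse W * integral {0..x} (\<lambda>s. f s * u s)" for x
  have pA: "unit_primitive A (\<lambda>x. inverse W * (f x * v x))"
    unfolding A_def using fv by (intro unit_primitive_cmult unit_primitive_indefinite)
  have pB: "unit_primitive B (\<lambda>x. 0 - inverse W * (f x * u x))"
    unfolding B_def using fu
    by (intro unit_primitive_diff unit_primitive_const unit_primitive_cmult unit_primitive_indefinite)
  have A: "A 0 = 0" "A 1 = 0" using orth by (auto simp: A_def)
  have B: "B 1 * \<sigma> = \<rho> * B 0"
  proof -
    have "B 0 = \<sigma> * b / (\<rho> - \<sigma>)" "B 1 = B 0 + b" by (auto simp: B_def b_def field_simps)
    then show ?thesis using distinct by (simp add: field_simps)
  qed
  have pu: "unit_primitive u u1" "unit_primitive u1 (\<lambda>x. (q x - z) * u x)"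
    and pv: "unit_primitive v v1" "unit_primitive v1 (\<lambda>x. (q x - z) * v x)"
    using u(1) v(1) by (auto simp: hill_solution_def)
  have w: "u x * v1 x - u1 x * v x = W" if "x \<in> {0..1}" for x
    using hill_wronskian_constant[OF u(1) v(1) that] by (simp add: W_def)
  define y where "y x = A x * u x + B x * v x" for x
  define y1 where "y1 x = A x * u1 x + B x * v1 x" for x
  show thesis
  proof (rule that[of y y1])
    show "unit_primitive y y1"
      unfolding y_def y1_def
      by (rule unit_primitive_cong[OF unit_primitive_add[OF unit_primitive_mult[OF pA pu(1)]
              unit_primitive_mult[OF pB pv(1)]]]) (auto simp: algebra_simps)
    show "unit_primitive y1 (\<lambda>x. q x * y x - (z * y x + f x))"
      unfolding y1_def
    proof (rule unit_primitive_cong[OF unit_primitive_add[OF unit_primitive_mult[OF pA pu(2)]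
              unit_primitive_mult[OF pB pv(2)]]])
      fix x :: real assume x: "x \<in> {0..1}"
      have "inverse W * (f x * v x) * u1 x + (0 - inverse W * (f x * u x)) * v1 x
          = - f x * (inverse W * (u x * v1 x - u1 x * v x))" by (simp add: algebra_simps)
      also have "\<dots> = - f x" using w[OF x] W_nonzero by simp
      finally show "inverse W * (f x * v x) * u1 x + A x * ((q x - z) * u x) +
         ((0 - inverse W * (f x * u x)) * v1 x + B x * ((q x - z) * v x)) =
         q x * y x - (z * y x + f x)"
        unfolding y_def by (simp add: algebra_simps)
    qed simp
    show "y 1 = \<rho> * y 0" "y1 1 = \<rho> * y1 0"
      using B v(2,3) by (auto simp: y_def y1_def A mult.assoc[symmetric])
  qed
qed

text \<open>The function \<open>g\<close> is orthogonal to the range of \<open>L\<^sub>t - z\<close>. Let \<open>f\<close> be the part of \<open>g\<close> orthogonal to the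
  conjugate of \<open>v\<close>. It lies in that range, hence it is orthogonal to \<open>g\<close>, hence to itself.\<close>

lemma adjoint_eigenfunction:
  assumes g: "normalized_eigenfunction (adjoint_graph (hill_op q t)) (cnj z) g" and \<rho>: "\<rho> = cis t"
  obtains \<kappa> where "cmod \<kappa> = 1" "AE x in lebesgue_on {0..1}. g x = \<kappa> * cnj (v x)"
proof -
  have gL: "g \<in> L2_unit" and g1: "L2_norm g = 1"
    and adj: "\<And>y f. (y, f) \<in> hill_op q t \<Longrightarrow> L2_inner f g = L2_inner y (\<lambda>x. cnj z * g x)"
    using g unfolding normalized_eigenfunction_def adjoint_graph_def by auto
  have vL: "v \<in> L2_unit" using hill_solution_continuous(1)[OF v(1)] by (rule continuous_imp_L2_unit)
  let ?M = "lebesgue_on {0..1::real}"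
  define \<kappa> where "\<kappa> = integral\<^sup>L ?M (\<lambda>x. g x * v x)"
  define f where "f x = g x - \<kappa> * cnj (v x)" for x
  have fL: "f \<in> L2_unit" unfolding f_def by (intro L2_unit_diff gL L2_unit_cmult L2_unit_cnj vL)
  have vv: "integral\<^sup>L ?M (\<lambda>x. cnj (v x) * v x) = 1"
    using L2_inner_self[of v] v(4) by (simp add: L2_inner_def mult.commute)
  have "integral\<^sup>L ?M (\<lambda>x. f x * v x) = integral\<^sup>L ?M (\<lambda>x. g x * v x - \<kappa> * (cnj (v x) * v x))"
    by (simp add: f_def algebra_simps)
  also have "\<dots> = \<kappa> - \<kappa> * 1"
    using L2_unit_mult_integrable[OF gL vL] L2_unit_mult_integrable[OF L2_unit_cnj[OF vL] vL]
    by (subst Bochner_Integration.integral_diff) (auto simp: vv \<kappa>_def)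
  finally have fv0: "integral\<^sup>L ?M (\<lambda>x. f x * v x) = 0" by simp
  then have "integral {0..1} (\<lambda>x. f x * v x) = 0"
    using lebesgue_integral_eq_integral[OF L2_unit_mult_integrable[OF fL vL]] by simp
  from range_contains_orthogonal[OF fL this]
  obtain y y1 where y: "unit_primitive y y1" "unit_primitive y1 (\<lambda>x. q x * y x - (z * y x + f x))"
    "y 1 = \<rho> * y 0" "y1 1 = \<rho> * y1 0" .
  have yL: "y \<in> L2_unit" using unit_primitive_continuous[OF y(1)] by (rule continuous_imp_L2_unit)
  have vd: "vector_derivative y (at x within {0..1}) = y1 x" if "x \<in> {0..1}" for x
    using unit_primitive_has_vector_derivative[OF y(1) unit_primitive_continuous[OF y(2)] that] that
    by (intro vector_derivative_within_closed_interval) auto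
  have "(y, \<lambda>x. z * y x + f x) \<in> hill_op q t"
    unfolding hill_op_def using yL fL y \<rho> unit_primitive_imp_hill_expr[OF y(1,2)]
    by (auto intro!: L2_unit_add L2_unit_cmult simp: vd)
  from adj[OF this] have eq: "L2_inner (\<lambda>x. z * y x + f x) g = L2_inner y (\<lambda>x. cnj z * g x)" .
  have cg: "(\<lambda>x. cnj (g x)) \<in> L2_unit" using gL by (rule L2_unit_cnj)
  note ig = L2_unit_mult_integrable[OF yL cg] L2_unit_mult_integrable[OF fL cg]
  have "L2_inner (\<lambda>x. z * y x + f x) g = integral\<^sup>L ?M (\<lambda>x. z * (y x * cnj (g x)) + f x * cnj (g x))"
    unfolding L2_inner_def by (simp add: algebra_simps)
  also have "\<dots> = z * integral\<^sup>L ?M (\<lambda>x. y x * cnj (g x)) + L2_inner f g"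
    using ig by (subst Bochner_Integration.integral_add) (auto simp: L2_inner_def)
  also have "z * integral\<^sup>L ?M (\<lambda>x. y x * cnj (g x)) = L2_inner y (\<lambda>x. cnj z * g x)"
    unfolding L2_inner_def by (subst integral_mult_right_zero[symmetric]) (simp add: mult_ac)
  finally have fg: "L2_inner f g = 0" using eq by simp
  have "L2_inner f f = integral\<^sup>L ?M (\<lambda>x. f x * cnj (g x) - cnj \<kappa> * (f x * v x))"
    unfolding L2_inner_def by (subst (2) f_def) (simp add: algebra_simps)
  also have "\<dots> = L2_inner f g - cnj \<kappa> * integral\<^sup>L ?M (\<lambda>x. f x * v x)"
    using ig L2_unit_mult_integrable[OF fL vL]
    by (subst Bochner_Integration.integral_diff) (auto simp: L2_inner_def)
  also have "\<dots> = 0" using fg fv0 by simp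
  finally have "AE x in ?M. f x = 0" using fL by (rule L2_inner_self_eq_0_imp_AE[rotated])
  then have ae: "AE x in ?M. g x = \<kappa> * cnj (v x)" unfolding f_def by auto
  have "1 = integral\<^sup>L ?M (\<lambda>x. (cmod (g x))\<^sup>2)" using g1 by (simp add: L2_norm_def)
  also have "\<dots> = integral\<^sup>L ?M (\<lambda>x. (cmod \<kappa>)\<^sup>2 * (cmod (v x))\<^sup>2)"
    using gL vL ae unfolding L2_unit_def
    by (intro integral_cong_AE) (auto simp: norm_mult power_mult_distrib)
  also have "\<dots> = (cmod \<kappa>)\<^sup>2 * integral\<^sup>L ?M (\<lambda>x. (cmod (v x))\<^sup>2)"
    by simp
  also have "integral\<^sup>L ?M (\<lambda>x. (cmod (v x))\<^sup>2) = 1" using v(4) by (simp add: L2_norm_def)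
  finally have "cmod \<kappa> = 1" by (simp add: power2_eq_1_iff) (metis norm_ge_zero not_one_le_zero le_minus_one_simps(3))
  then show thesis using ae that by blast
qed

lemma cmod_inner_adjoint:
  assumes "normalized_eigenfunction (adjoint_graph (hill_op q t)) (cnj z) g" "\<rho> = cis t"
  shows "cmod (L2_inner u g) * cmod (\<rho> - \<sigma>) = cmod (discriminant_deriv z) * cmod W"
proof -
  obtain \<kappa> where k: "cmod \<kappa> = 1" "AE x in lebesgue_on {0..1}. g x = \<kappa> * cnj (v x)"
    using adjoint_eigenfunction[OF assms] .
  have cu: "continuous_on {0..1} u" "continuous_on {0..1} v"
    using hill_solution_continuous(1) u(1) v(1) by blast+
  have L: "g \<in> L2_unit" "u \<in> L2_unit" "v \<in> L2_unit"
    using assms(1) continuous_imp_L2_unit cu unfolding normalized_eigenfunction_def adjoint_graph_def by auto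
  have "L2_inner u g = integral\<^sup>L (lebesgue_on {0..1}) (\<lambda>x. cnj \<kappa> * (u x * v x))"
    unfolding L2_inner_def
  proof (rule integral_cong_AE)
    show "(\<lambda>x. u x * cnj (g x)) \<in> borel_measurable (lebesgue_on {0..1})"
      by (intro borel_measurable_integrable L2_unit_mult_integrable L L2_unit_cnj)
    show "(\<lambda>x. cnj \<kappa> * (u x * v x)) \<in> borel_measurable (lebesgue_on {0..1})"
      by (intro borel_measurable_integrable integrable_mult_right L2_unit_mult_integrable L)
    show "AE x in lebesgue_on {0..1}. u x * cnj (g x) = cnj \<kappa> * (u x * v x)"
      using k(2) by auto
  qed
  also have "\<dots> = cnj \<kappa> * integral\<^sup>L (lebesgue_on {0..1}) (\<lambda>x. u x * v x)" by simp
  also have "integral\<^sup>L (lebesgue_on {0..1}) (\<lambda>x. u x * v x) = integral {0..1} (\<lambda>x. u x * v x)"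
    using cu by (intro integral_unit_interval_eq continuous_intros)
  finally have "cmod (L2_inner u g) = cmod (integral {0..1} (\<lambda>x. u x * v x))"
    using k(1) by (simp add: norm_mult)
  then show ?thesis using arg_cong[OF integral_uv, of cmod] by (simp add: norm_mult mult.commute)
qed

end

section \<open>Continuity of the Wronskian of normalized Floquet solutions\<close>

context hill_system begin

text \<open>The entries, row by row, of \<open>(M - \<sigma>) / (\<rho> - \<sigma>)\<close> for the monodromy matrix \<open>M\<close>: the projection onto
  the eigenspace for \<open>\<rho>\<close> along the one for \<open>\<sigma>\<close>.\<close>

definition floquet_projection :: "complex \<Rightarrow> complex \<Rightarrow> complex \<Rightarrow> complex \<times> complex \<times> complex \<times> complex" where
  "floquet_projection z \<rho> \<sigma> = ((\<theta> 1 z - \<sigma>) / (\<rho> - \<sigma>), \<phi> 1 z / (\<rho> - \<sigma>), \<theta>1 1 z / (\<rho> - \<sigma>), (\<phi>1 1 z - \<sigma>) / (\<rho> - \<sigma>))"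

text \<open>The norm of the solution with initial data \<open>(a, b)\<close>.\<close>

definition solution_norm :: "complex \<Rightarrow> complex \<Rightarrow> complex \<Rightarrow> real" where
  "solution_norm z a b = L2_norm (\<lambda>x. a * \<theta> x z + b * \<phi> x z)"

definition floquet_projection_size :: "complex \<Rightarrow> complex \<Rightarrow> complex \<Rightarrow> real" where
  "floquet_projection_size z \<rho> \<sigma> = (case floquet_projection z \<rho> \<sigma> of (a, b, c, d) \<Rightarrow> cmod a + cmod b + cmod c + cmod d)"

text \<open>The projection has rank one, with entries \<open>u\<^sub>i v\<^sub>j / W\<close> up to sign. Read as initial values, its columns
  give multiples of \<open>u\<close> and its rows, after a quarter turn, multiples of \<open>v\<close>. For normalized \<open>u\<close>, \<open>v\<close> the
  norms of these solutions are therefore the numbers \<open>|v\<^sub>j / W|\<close> and \<open>|u\<^sub>i / W|\<close>, and \<open>W\<close> is recovered by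
  comparing their products with the entries. Summing over all entries avoids dividing by one
  that vanishes. The formula refers to no choice of \<open>u\<close> and \<open>v\<close>, which makes its continuity
  accessible.\<close>

definition inv_wronskian :: "complex \<Rightarrow> complex \<Rightarrow> complex \<Rightarrow> real" where
  "inv_wronskian z \<rho> \<sigma> = (case floquet_projection z \<rho> \<sigma> of (a, b, c, d) \<Rightarrow>
     (solution_norm z (- b) a + solution_norm z (- d) c) * (solution_norm z a c + solution_norm z b d)
      / floquet_projection_size z \<rho> \<sigma>)"

lemma uniform_limit_compose_param:
  assumes "\<And>z. uniform_limit A (\<lambda>w x. Y x w) (\<lambda>x. Y x z) (at z)" "(z \<longlongrightarrow> z0) F"
  shows "uniform_limit A (\<lambda>s x. Y x (z s)) (\<lambda>x. Y x z0) F"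
proof -
  have "uniform_limit A (\<lambda>w x. Y x w) (\<lambda>x. Y x z0) (nhds z0)"
    using assms(1)[of z0] unfolding uniform_limit_iff eventually_nhds_conv_at by auto
  from filterlim_compose[OF this assms(2)] show ?thesis .
qed

lemma solution_norm_tendsto:
  assumes z: "(z \<longlongrightarrow> z0) F" and p: "(p \<longlongrightarrow> p0) F" and r: "(r \<longlongrightarrow> r0) F" and F: "F \<noteq> bot"
  shows "((\<lambda>s. solution_norm (z s) (p s) (r s)) \<longlongrightarrow> solution_norm z0 p0 r0) F"
proof -
  note [continuous_intros] = continuous_\<theta>\<phi>
  have bd: "bounded (f ` {0..1})" if "continuous_on {0..1} f" for f :: "real \<Rightarrow> complex"
    using that by (intro compact_imp_bounded compact_continuous_image) auto
  have const: "uniform_limit {0..1::real} (\<lambda>s x. p s) (\<lambda>x. p0) F" if "(p \<longlongrightarrow> p0) F" for p and p0 :: complex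
    using that unfolding uniform_limit_iff tendsto_iff by auto
  have "uniform_limit {0..1} (\<lambda>s x. p s * \<theta> x (z s) + r s * \<phi> x (z s)) (\<lambda>x. p0 * \<theta> x z0 + r0 * \<phi> x z0) F"
    by (intro uniform_limit_add uniform_lim_mult const p r bd continuous_intros
        uniform_limit_compose_param[OF uniform_limit_\<theta> z] uniform_limit_compose_param[OF uniform_limit_\<phi> z])
  from uniform_limit_norm[OF this]
  have n: "uniform_limit {0..1} (\<lambda>s x. cmod (p s * \<theta> x (z s) + r s * \<phi> x (z s))) (\<lambda>x. cmod (p0 * \<theta> x z0 + r0 * \<phi> x z0)) F" .
  have cn: "continuous_on {0..1} (\<lambda>x. cmod (p * \<theta> x z + r * \<phi> x z))" for p z r
    by (intro continuous_intros)
  have bn: "bounded ((\<lambda>x. cmod (p0 * \<theta> x z0 + r0 * \<phi> x z0)) ` {0..1})"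
    by (intro compact_imp_bounded compact_continuous_image cn) auto
  have "uniform_limit {0..1} (\<lambda>s x. (cmod (p s * \<theta> x (z s) + r s * \<phi> x (z s)))\<^sup>2) (\<lambda>x. (cmod (p0 * \<theta> x z0 + r0 * \<phi> x z0))\<^sup>2) F"
    unfolding power2_eq_square by (intro uniform_lim_mult n bn)
  then obtain I J where IJ: "\<And>s. ((\<lambda>x. (cmod (p s * \<theta> x (z s) + r s * \<phi> x (z s)))\<^sup>2) has_integral I s) {0..1}"
    "((\<lambda>x. (cmod (p0 * \<theta> x z0 + r0 * \<phi> x z0))\<^sup>2) has_integral J) {0..1}" "(I \<longlongrightarrow> J) F"
    by (rule uniform_limit_integral[OF _ _ F]) (intro continuous_intros, auto)
  have eq: "solution_norm z a b = sqrt (integral {0..1} (\<lambda>x. (cmod (a * \<theta> x z + b * \<phi> x z))\<^sup>2))" for z a b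
    unfolding solution_norm_def L2_norm_def
    by (intro arg_cong[of _ _ sqrt] lebesgue_integral_eq_integral absolutely_integrable_imp_integrable
        absolutely_integrable_continuous_real continuous_intros) auto
  show ?thesis unfolding eq integral_unique[OF IJ(1)] integral_unique[OF IJ(2)]
    by (intro tendsto_intros IJ(3))
qed

lemma inv_wronskian_tendsto:
  assumes z: "(z \<longlongrightarrow> z0) F" and r: "(\<rho> \<longlongrightarrow> \<rho>0) F" "(\<sigma> \<longlongrightarrow> \<sigma>0) F" "\<rho>0 \<noteq> \<sigma>0"
    and F: "F \<noteq> bot" and nz: "floquet_projection_size z0 \<rho>0 \<sigma>0 \<noteq> 0"
  shows "((\<lambda>s. inv_wronskian (z s) (\<rho> s) (\<sigma> s)) \<longlongrightarrow> inv_wronskian z0 \<rho>0 \<sigma>0) F"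
proof -
  have "((\<lambda>s. \<theta> 1 (z s)) \<longlongrightarrow> \<theta> 1 z0) F" "((\<lambda>s. \<phi> 1 (z s)) \<longlongrightarrow> \<phi> 1 z0) F"
    "((\<lambda>s. \<theta>1 1 (z s)) \<longlongrightarrow> \<theta>1 1 z0) F" "((\<lambda>s. \<phi>1 1 (z s)) \<longlongrightarrow> \<phi>1 1 z0) F"
    by (rule isCont_tendsto_compose[OF monodromy_isCont(1) z] isCont_tendsto_compose[OF monodromy_isCont(2) z]
       isCont_tendsto_compose[OF monodromy_isCont(3) z] isCont_tendsto_compose[OF monodromy_isCont(4) z])+
  note [tendsto_intros] = this r(1,2) solution_norm_tendsto[OF z _ _ F]
  show ?thesis
    unfolding inv_wronskian_def floquet_projection_size_def floquet_projection_def prod.case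
    by (intro tendsto_intros) (use r(3) nz in \<open>auto simp: floquet_projection_size_def floquet_projection_def\<close>)
qed

end

context floquet_pair begin

lemma floquet_projection_eq: "floquet_projection z \<rho> \<sigma> = (u 0 * v1 0 / W, - (u 0 * v 0 / W), u1 0 * v1 0 / W, - (u1 0 * v 0 / W))"
proof -
  have quotient: "p / (\<rho> - \<sigma>) = c / W" if "p * W = (\<rho> - \<sigma>) * c" for p c
    using that distinct W_nonzero by (simp add: frac_eq_eq mult.commute)
  have e: "(\<theta> 1 z - \<sigma>) * W = (\<rho> - \<sigma>) * (u 0 * v1 0)" "(\<phi>1 1 z - \<sigma>) * W = (\<rho> - \<sigma>) * (- (u1 0 * v 0))"
    "\<phi> 1 z * W = (\<rho> - \<sigma>) * (- (u 0 * v 0))"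
    using monodromy_times_W unfolding W_def by algebra+
  show ?thesis
    unfolding floquet_projection_def minus_divide_left
    using quotient[OF e(1)] quotient[OF e(2)] quotient[OF e(3)] quotient[OF monodromy_times_W(2)] by simp
qed

lemma initial_data_pos: "cmod (u 0) + cmod (u1 0) > 0" "cmod (v 0) + cmod (v1 0) > 0"
  using solution_initial_nonzero[OF u(1)] solution_initial_nonzero[OF v(1)] u(4) v(4)
  by (auto simp: add_pos_nonneg add_nonneg_pos)

lemma floquet_projection_size_eq: "floquet_projection_size z \<rho> \<sigma> = (cmod (u 0) + cmod (u1 0)) * (cmod (v 0) + cmod (v1 0)) / cmod W"
  unfolding floquet_projection_size_def floquet_projection_eq by (simp add: norm_mult norm_divide add_divide_distrib algebra_simps)

lemma floquet_projection_size_nonzero: "floquet_projection_size z \<rho> \<sigma> \<noteq> 0"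
  using initial_data_pos W_nonzero unfolding floquet_projection_size_eq by auto

lemma inv_wronskian_eq: "inv_wronskian z \<rho> \<sigma> = 1 / cmod W"
proof -
  have U: "solution_norm z (u 0 * c) (u1 0 * c) = cmod c" and V: "solution_norm z (v 0 * c) (v1 0 * c) = cmod c" for c
  proof -
    have "solution_norm z (u 0 * c) (u1 0 * c) = L2_norm (\<lambda>x. c * u x)"
      unfolding solution_norm_def
    proof (rule L2_norm_cong)
      fix x :: real assume "x \<in> {0..1}"
      from solution_expand(1)[OF u(1) this]
      show "u 0 * c * \<theta> x z + u1 0 * c * \<phi> x z = c * u x" by (simp add: distrib_left mult_ac)
    qed
    then show "solution_norm z (u 0 * c) (u1 0 * c) = cmod c" by (simp add: L2_norm_cmult u(4))
    have "solution_norm z (v 0 * c) (v1 0 * c) = L2_norm (\<lambda>x. c * v x)"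
      unfolding solution_norm_def
    proof (rule L2_norm_cong)
      fix x :: real assume "x \<in> {0..1}"
      from solution_expand(1)[OF v(1) this]
      show "v 0 * c * \<theta> x z + v1 0 * c * \<phi> x z = c * v x" by (simp add: distrib_left mult_ac)
    qed
    then show "solution_norm z (v 0 * c) (v1 0 * c) = cmod c" by (simp add: L2_norm_cmult v(4))
  qed
  have "solution_norm z (u 0 * v 0 / W) (u 0 * v1 0 / W) = cmod (u 0) / cmod W"
    "solution_norm z (u1 0 * v 0 / W) (u1 0 * v1 0 / W) = cmod (u1 0) / cmod W"
    "solution_norm z (u 0 * v1 0 / W) (u1 0 * v1 0 / W) = cmod (v1 0) / cmod W"
    "solution_norm z (- (u 0 * v 0 / W)) (- (u1 0 * v 0 / W)) = cmod (v 0) / cmod W"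
    using V[of "u 0 / W"] V[of "u1 0 / W"] U[of "v1 0 / W"] U[of "- v 0 / W"]
    by (simp_all add: norm_divide mult.commute)
  then have "inv_wronskian z \<rho> \<sigma> = (cmod (u 0) / cmod W + cmod (u1 0) / cmod W) * (cmod (v1 0) / cmod W + cmod (v 0) / cmod W)
      / floquet_projection_size z \<rho> \<sigma>"
    unfolding inv_wronskian_def floquet_projection_eq by simp
  also have "\<dots> = 1 / cmod W"
  proof -
    have alg: "(a / w + b / w) * (d / w + c / w) / ((a + b) * (c + d) / w) = 1 / w"
      if "a + b > 0" "c + d > 0" "w > 0" for a b c d w :: real
    proof -
      have "(a / w + b / w) * (d / w + c / w) = ((a + b) * (c + d) / w) * (1 / w)"
        by (simp add: add_divide_distrib[symmetric] add.commute)
      moreover have "(a + b) * (c + d) / w \<noteq> 0" using that by simp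
      ultimately show ?thesis by simp
    qed
    show ?thesis unfolding floquet_projection_size_eq using initial_data_pos W_nonzero by (intro alg) auto
  qed
  finally show ?thesis .
qed

end

context hill_system begin

text \<open>The solution \<open>v\<close> with the second multiplier comes from the operator with parameter \<open>- t\<close>, which
  has the same eigenvalue.\<close>

lemma cmod_eigenfunction_pairing:
  assumes t: "sin t \<noteq> 0"
    and u: "normalized_eigenfunction (hill_op q t) z u"
    and v: "normalized_eigenfunction (hill_op q (- t)) z v"
    and g: "normalized_eigenfunction (adjoint_graph (hill_op q t)) (cnj z) g"
  shows "inv_wronskian z (cis t) (cis (- t)) > 0"
    and "floquet_projection_size z (cis t) (cis (- t)) \<noteq> 0"
    and "cmod (L2_inner u g) * (2 * \<bar>sin t\<bar> * inv_wronskian z (cis t) (cis (- t))) = cmod (discriminant_deriv z)"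
proof -
  obtain u1 where u1: "hill_solution q z u u1" "u 1 = cis t * u 0" "u1 1 = cis t * u1 0"
    using u hill_op_eigen_solution unfolding normalized_eigenfunction_def by blast
  obtain v1 where v1: "hill_solution q z v v1" "v 1 = cis (-t) * v 0" "v1 1 = cis (-t) * v1 0"
    using v hill_op_eigen_solution unfolding normalized_eigenfunction_def by blast
  have c: "cis t - cis (- t) = 2 * \<i> * of_real (sin t)" by (simp add: complex_eq_iff)
  have ne: "cis t \<noteq> cis (- t)" using t by (simp add: complex_eq_iff)
  interpret floquet_pair q \<theta> \<theta>1 \<phi> \<phi>1 z "cis t" "cis (- t)" u u1 v v1
    using u1 v1 ne u v unfolding normalized_eigenfunction_def by unfold_locales auto
  have W: "cmod W > 0" using W_nonzero by simp
  then show "inv_wronskian z (cis t) (cis (- t)) > 0" by (simp add: inv_wronskian_eq)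
  show "floquet_projection_size z (cis t) (cis (- t)) \<noteq> 0" by (rule floquet_projection_size_nonzero)
  show "cmod (L2_inner u g) * (2 * \<bar>sin t\<bar> * inv_wronskian z (cis t) (cis (- t))) = cmod (discriminant_deriv z)"
    using cmod_inner_adjoint[OF g refl] W unfolding c inv_wronskian_eq by (simp add: norm_mult field_simps)
qed

end

section \<open>Zeros of the discriminant along a branch of eigenvalues\<close>

text \<open>Write \<open>F w - F z = g w (w - z)^m\<close> with \<open>g z \<noteq> 0\<close>. Then \<open>F' w = h w (w - z)^(m - 1)\<close> with
  \<open>h z = m g z \<noteq> 0\<close>, and the power \<open>1 - 1/m\<close> turns \<open>|w - z|^m\<close> into \<open>|w - z|^(m - 1)\<close>.\<close>

lemma holomorphic_deriv_lower_bound: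
  fixes F :: "complex \<Rightarrow> complex"
  assumes hol: "F holomorphic_on UNIV" and nc: "\<exists>w. F w \<noteq> F z"
  obtains m c r where "m = nat (zorder (\<lambda>w. F w - F z) z)" "m > 0" "c > 0" "r > 0"
    "\<And>w. w \<in> ball z r \<Longrightarrow> c * cmod (F w - F z) powr (1 - 1 / real m) \<le> cmod (deriv F w)"
    "deriv F z = 0 \<longleftrightarrow> m \<ge> 2"
proof -
  define m where "m = nat (zorder (\<lambda>w. F w - F z) z)"
  define g where "g = zor_poly (\<lambda>w. F w - F z) z"
  have hol': "(\<lambda>w. F w - F z) holomorphic_on UNIV" using hol by (intro holomorphic_intros)
  have "m > 0 \<and> (\<exists>r>0. g holomorphic_on cball z r \<and>
      (\<forall>w\<in>cball z r. F w - F z = g w * (w - z) ^ m \<and> g w \<noteq> 0))"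
    using zorder_exist_zero[OF hol' open_UNIV connected_UNIV UNIV_I[of z]] nc
    by (auto simp: m_def g_def)
  then obtain r where m: "m > 0" and r: "r > 0" and gh: "g holomorphic_on cball z r"
    and fact: "\<And>w. w \<in> cball z r \<Longrightarrow> F w - F z = g w * (w - z) ^ m \<and> g w \<noteq> 0"
    by blast
  have gb: "g holomorphic_on ball z r" using gh by (rule holomorphic_on_subset) auto
  define h where "h w = deriv g w * (w - z) + of_nat m * g w" for w
  have F': "deriv F w = h w * (w - z) ^ (m - 1)" if w: "w \<in> ball z r" for w
  proof -
    have g': "(g has_field_derivative deriv g w) (at w)"
      using gb w by (intro holomorphic_derivI) auto
    have "((\<lambda>w. g w * (w - z) ^ m + F z) has_field_derivative
        deriv g w * (w - z) ^ m + of_nat m * (w - z) ^ (m - 1) * g w) (at w)"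
      by (auto intro!: derivative_eq_intros g')
    moreover have e: "(w - z) ^ m = (w - z) * (w - z) ^ (m - 1)" using m by (cases m) auto
    have "deriv g w * (w - z) ^ m + of_nat m * (w - z) ^ (m - 1) * g w = h w * (w - z) ^ (m - 1)"
      unfolding e h_def by algebra
    ultimately have "((\<lambda>w. g w * (w - z) ^ m + F z) has_field_derivative h w * (w - z) ^ (m - 1)) (at w)"
      by (simp only:)
    then have "(F has_field_derivative h w * (w - z) ^ (m - 1)) (at w)"
    proof (rule has_field_derivative_transform_within_open[OF _ open_ball w])
      fix x assume "x \<in> ball z r"
      then show "g x * (x - z) ^ m + F z = F x" using fact[of x] by (simp add: algebra_simps)
    qed
    then show ?thesis by (rule DERIV_imp_deriv)
  qed
  have hz: "h z = of_nat m * g z" by (simp add: h_def)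
  have gz: "g z \<noteq> 0" using fact[of z] r by auto
  have hz0: "h z \<noteq> 0" using gz m by (simp add: hz)
  have "isCont g z" "isCont (deriv g) z"
    using r holomorphic_on_imp_continuous_on[OF gb]
      holomorphic_on_imp_continuous_on[OF holomorphic_deriv[OF gb open_ball]]
    by (auto simp: continuous_on_eq_continuous_at)
  then have "isCont (\<lambda>w. cmod (g w)) z" "isCont (\<lambda>w. cmod (h w)) z"
    unfolding h_def by (auto intro!: continuous_intros)
  then have c: "((\<lambda>w. cmod (g w)) \<longlongrightarrow> cmod (g z)) (nhds z)" "((\<lambda>w. cmod (h w)) \<longlongrightarrow> cmod (h z)) (nhds z)"
    unfolding isCont_def
    using tendsto_at_iff_tendsto_nhds[of "\<lambda>w. cmod (g w)" z]
      tendsto_at_iff_tendsto_nhds[of "\<lambda>w. cmod (h w)" z] by blast+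
  define G where "G = 2 * cmod (g z)"
  have G: "G > 0" using gz by (simp add: G_def)
  have "\<forall>\<^sub>F w in nhds z. cmod (g w) < G \<and> cmod (h w) > cmod (h z) / 2 \<and> w \<in> ball z r"
    using r gz hz0 by (intro eventually_conj order_tendstoD[OF c(1)] order_tendstoD[OF c(2)] eventually_nhds_in_open)
      (auto simp: G_def)
  then obtain d where d: "d > 0" "\<And>w. dist w z < d \<Longrightarrow> cmod (g w) < G \<and> cmod (h w) > cmod (h z) / 2 \<and> w \<in> ball z r"
    unfolding eventually_nhds_metric by blast
  define p where "p = 1 - 1 / real m"
  have p: "0 \<le> p" "real m * p = real (m - 1)" using m by (auto simp: p_def field_simps of_nat_diff)
  have bound: "cmod (h z) / 2 / G powr p * cmod (F w - F z) powr p \<le> cmod (deriv F w)" if w: "w \<in> ball z d" for w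
  proof (cases "w = z")
    case False
    define x where "x = cmod (w - z)"
    have x: "x > 0" using False by (simp add: x_def)
    have wd: "cmod (g w) < G" "cmod (h w) > cmod (h z) / 2" "w \<in> ball z r"
      using d(2)[of w] w by (auto simp: dist_commute)
    have "cmod (F w - F z) = cmod (g w) * x ^ m"
      using fact[of w] wd(3) by (simp add: norm_mult norm_power x_def)
    also have "\<dots> \<le> G * x ^ m" using wd(1) x by (intro mult_right_mono) auto
    finally have "cmod (F w - F z) powr p \<le> (G * x ^ m) powr p"
      using p by (intro powr_mono2) auto
    also have "\<dots> = G powr p * (x powr real m) powr p"
      using x G by (simp add: powr_mult powr_realpow)
    also have "(x powr real m) powr p = x ^ (m - 1)"
      unfolding powr_powr p(2) using x by (rule powr_realpow)
    finally have "cmod (h z) / 2 / G powr p * cmod (F w - F z) powr p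
       \<le> cmod (h z) / 2 / G powr p * (G powr p * x ^ (m - 1))"
      by (intro mult_left_mono) auto
    also have "\<dots> = cmod (h z) / 2 * x ^ (m - 1)" using G by simp
    also have "\<dots> \<le> cmod (h w) * x ^ (m - 1)" using wd(2) x by (intro mult_right_mono) auto
    also have "\<dots> = cmod (deriv F w)" using F'[OF wd(3)] by (simp add: norm_mult norm_power x_def)
    finally show ?thesis .
  qed simp
  have "deriv F z = h z * (z - z) ^ (m - 1)" using r by (intro F') auto
  then have "deriv F z = 0 \<longleftrightarrow> m \<ge> 2" using hz0 m by (auto simp: power_0_left split: if_splits)
  moreover have "cmod (h z) / 2 / G powr p > 0" using hz0 G by simp
  ultimately show thesis using that[OF m_def m _ d(1)] bound unfolding p_def by blast
qed

lemma root_multiplicity_ge_2_iff: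
  assumes "F holomorphic_on UNIV" "\<exists>w. F w \<noteq> 2 * cos (of_real t)"
  shows "root_multiplicity F t z \<ge> 2 \<longleftrightarrow> F z = 2 * cos (of_real t) \<and> deriv F z = 0"
proof (cases "F z = 2 * cos (of_real t)")
  case True
  with assms(2) have "\<exists>w. F w \<noteq> F z" by simp
  from holomorphic_deriv_lower_bound[OF assms(1) this]
  obtain m where "m = nat (zorder (\<lambda>w. F w - F z) z)" "deriv F z = 0 \<longleftrightarrow> m \<ge> 2" .
  then show ?thesis using True by (simp add: root_multiplicity_def)
qed (simp add: root_multiplicity_def)

lemma cos_diff_lower_bound:
  fixes t :: real
  assumes "sin t \<noteq> 0"
  obtains c d where "c > 0" "d > 0" "\<And>s. \<bar>s - t\<bar> < d \<Longrightarrow> c * \<bar>s - t\<bar> \<le> \<bar>2 * cos s - 2 * cos t\<bar>"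
proof -
  have "((\<lambda>s. (cos s - cos t) / (s - t)) \<longlongrightarrow> - sin t) (at t)"
    using DERIV_cos[of t] unfolding has_field_derivative_iff .
  then have "((\<lambda>s. \<bar>(cos s - cos t) / (s - t)\<bar>) \<longlongrightarrow> \<bar>- sin t\<bar>) (at t)"
    by (rule tendsto_rabs)
  then have "\<forall>\<^sub>F s in at t. \<bar>(cos s - cos t) / (s - t)\<bar> > \<bar>sin t\<bar> / 2"
    using assms by (intro order_tendstoD(1)) auto
  then obtain d where d: "d > 0" "\<And>s. s \<noteq> t \<Longrightarrow> dist s t < d \<Longrightarrow> \<bar>(cos s - cos t) / (s - t)\<bar> > \<bar>sin t\<bar> / 2"
    unfolding eventually_at by auto
  show thesis
  proof (rule that[of "\<bar>sin t\<bar>" d])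
    fix s assume s: "\<bar>s - t\<bar> < d"
    show "\<bar>sin t\<bar> * \<bar>s - t\<bar> \<le> \<bar>2 * cos s - 2 * cos t\<bar>"
    proof (cases "s = t")
      case False
      then have "\<bar>sin t\<bar> / 2 < \<bar>cos s - cos t\<bar> / \<bar>s - t\<bar>"
        using d(2)[OF False] s by (simp add: dist_real_def abs_divide)
      then have "\<bar>sin t\<bar> / 2 * \<bar>s - t\<bar> < \<bar>cos s - cos t\<bar>"
        using False by (subst (asm) pos_less_divide_eq) auto
      then show ?thesis by linarith
    qed simp
  qed (use assms d in auto)
qed

lemma abs_powr_integrable:
  fixes t p d :: real
  assumes "p < 1" "d \<ge> 0"
  shows "(\<lambda>s. \<bar>s - t\<bar> powr (- p)) integrable_on {t - d..t + d}"
proof -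
  have "(\<lambda>x. x powr (- p)) integrable_on {0..d}"
    using assms by (intro integrable_on_powr_from_0) auto
  then have 1: "(\<lambda>x. \<bar>x\<bar> powr (- p)) integrable_on {0..d}"
    by (rule integrable_eq) auto
  have "(\<lambda>x. \<bar>x\<bar> powr (- p)) integrable_on {-d..0}"
    using Henstock_Kurzweil_Integration.integrable_reflect_real[of "\<lambda>x. \<bar>x\<bar> powr (- p)" d 0] 1 by simp
  from Henstock_Kurzweil_Integration.integrable_combine[OF _ _ this 1] assms
  have "(\<lambda>x. \<bar>x\<bar> powr (- p)) integrable_on {-d..d}" by simp
  then obtain I where "((\<lambda>x. \<bar>x\<bar> powr (- p)) has_integral I) {-d..d}" by blast
  moreover have "(\<lambda>x. \<bar>x\<bar> powr (- p)) = (\<lambda>s. \<bar>s - t\<bar> powr (- p)) \<circ> (+) t" by auto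
  ultimately have "((\<lambda>s. \<bar>s - t\<bar> powr (- p)) has_integral I) {- d + t..d + t}"
    using has_integral_shift_Icc_real[of "\<lambda>s. \<bar>s - t\<bar> powr (- p)" t I "-d" d] by simp
  moreover have "{- d + t..d + t} = {t - d..t + d}" by (simp add: add.commute)
  ultimately show ?thesis unfolding integrable_on_def by metis
qed

lemma punctured_interval_lebesgue: "{t - e<..<t + e} - {t :: real} \<in> sets lebesgue"
proof (rule sets_completionI_sets)
  show "{t - e<..<t + e} - {t} \<in> sets lborel" unfolding sets_lborel by (rule sets.Diff) auto
qed

text \<open>The parameters in a period for which the two multipliers are distinct.\<close>

definition punctured_period :: "real set" where
  "punctured_period = {-pi<..<0} \<union> {0<..<pi}"

lemma open_punctured_period: "open punctured_period"
  by (simp add: punctured_period_def open_Un)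

lemma sin_nonzero_punctured_period: "t \<in> punctured_period \<Longrightarrow> sin t \<noteq> 0"
  using sin_gt_zero[of t] sin_gt_zero[of "-t"] by (auto simp: punctured_period_def)

text \<open>All that the rest of the argument uses of the operators: \<open>c\<close> is a branch of eigenvalues, \<open>a\<close> the
  modulus of \<open>\<alpha>\<close>, and \<open>K\<close> is \<open>2 |sin t| / |W|\<close>.\<close>

locale spectral_branch =
  fixes F :: "complex \<Rightarrow> complex" and c :: "real \<Rightarrow> complex" and a K :: "real \<Rightarrow> real"
  assumes holo: "F holomorphic_on UNIV"
    and on_curve: "\<And>t. t \<in> {-pi..pi} \<Longrightarrow> F (c t) = 2 * cos (of_real t)"
    and cont_c: "continuous_on punctured_period c"
    and cont_K: "continuous_on punctured_period K"
    and K_pos: "\<And>t. t \<in> punctured_period \<Longrightarrow> K t > 0"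
    and pairing: "\<And>t. t \<in> punctured_period \<Longrightarrow> a t * K t = cmod (deriv F (c t))"
begin

text \<open>At the ends of the interval \<open>{0..pi}\<close> the values on the branch are \<open>2\<close> and \<open>- 2\<close>.\<close>

lemma nonconstant: "\<exists>w. F w \<noteq> b"
proof -
  have "F (c 0) = 2" "F (c pi) = -2"
    using on_curve[of 0] on_curve[of pi] by (auto simp: cos_of_real)
  then have "F (c 0) \<noteq> F (c pi)" by simp
  then show ?thesis by metis
qed

lemma isCont_curve: "t \<in> punctured_period \<Longrightarrow> isCont c t" and isCont_K: "t \<in> punctured_period \<Longrightarrow> isCont K t"
  using cont_c cont_K open_punctured_period by (auto simp: continuous_on_eq_continuous_at)

lemma curve_diff: "s \<in> {-pi..pi} \<Longrightarrow> t \<in> {-pi..pi} \<Longrightarrow> cmod (F (c s) - F (c t)) = \<bar>2 * cos s - 2 * cos t\<bar>"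
proof -
  assume "s \<in> {-pi..pi}" "t \<in> {-pi..pi}"
  then have "F (c s) - F (c t) = of_real (2 * cos s - 2 * cos t)"
    by (simp add: on_curve cos_of_real)
  then show ?thesis by (simp only: norm_of_real)
qed

text \<open>On the branch \<open>F (c s) - F (c t) = 2 cos s - 2 cos t\<close> has exact order \<open>s - t\<close>, so the lower bound for
  \<open>F'\<close> in terms of this difference becomes one in terms of the parameter.\<close>

lemma pairing_lower_bound:
  assumes t: "t \<in> punctured_period"
  obtains d p C where "d > 0" "p < 1" "{t - d<..<t + d} \<subseteq> punctured_period"
    "\<And>s. s \<in> {t - d<..<t + d} - {t} \<Longrightarrow> deriv F (c s) \<noteq> 0 \<and> 1 / a s \<le> C * \<bar>s - t\<bar> powr (- p)"
proof -
  obtain m b r where m: "m > 0" and b: "b > 0" and r: "r > 0" and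
    low: "\<And>w. w \<in> ball (c t) r \<Longrightarrow> b * cmod (F w - F (c t)) powr (1 - 1 / real m) \<le> cmod (deriv F w)"
    using holomorphic_deriv_lower_bound[OF holo nonconstant] by metis
  obtain k d1 where k: "k > 0" and d1: "d1 > 0"
    and cosb: "\<And>s. \<bar>s - t\<bar> < d1 \<Longrightarrow> k * \<bar>s - t\<bar> \<le> \<bar>2 * cos s - 2 * cos t\<bar>"
    using cos_diff_lower_bound[OF sin_nonzero_punctured_period[OF t]] by blast
  define p where "p = 1 - 1 / real m"
  have p: "0 \<le> p" "p < 1" using m by (auto simp: p_def)
  have ct: "(c \<longlongrightarrow> c t) (nhds t)" "(K \<longlongrightarrow> K t) (nhds t)"
    using isCont_curve[OF t] isCont_K[OF t] by (simp_all add: isCont_def tendsto_at_iff_tendsto_nhds)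
  have "\<forall>\<^sub>F s in nhds t. c s \<in> ball (c t) r \<and> K s < K t + 1 \<and> s \<in> punctured_period \<and> s \<in> {t - d1<..<t + d1}"
    using r d1 t open_punctured_period
    by (intro eventually_conj topological_tendstoD[OF ct(1)] order_tendstoD(2)[OF ct(2)] eventually_nhds_in_open) auto
  then obtain d where d: "d > 0"
    and near: "\<And>s. dist s t < d \<Longrightarrow> c s \<in> ball (c t) r \<and> K s < K t + 1 \<and> s \<in> punctured_period \<and> s \<in> {t - d1<..<t + d1}"
    unfolding eventually_nhds_metric by blast
  define C where "C = (K t + 1) / (b * k powr p)"
  show thesis
  proof (rule that[OF d p(2)])
    show "{t - d<..<t + d} \<subseteq> punctured_period" using near by (auto simp: dist_real_def abs_less_iff)
    fix s assume s: "s \<in> {t - d<..<t + d} - {t}"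
    then have n: "c s \<in> ball (c t) r" "K s < K t + 1" "s \<in> punctured_period" "\<bar>s - t\<bar> < d1"
      using near[of s] by (auto simp: dist_real_def abs_less_iff)
    have st: "s \<in> {-pi..pi}" "t \<in> {-pi..pi}" using n(3) t by (auto simp: punctured_period_def)
    have x: "\<bar>s - t\<bar> > 0" using s by auto
    have "k powr p * \<bar>s - t\<bar> powr p = (k * \<bar>s - t\<bar>) powr p" using k by (simp add: powr_mult)
    also have "\<dots> \<le> cmod (F (c s) - F (c t)) powr p"
      unfolding curve_diff[OF st] using cosb[OF n(4)] k p by (intro powr_mono2) auto
    finally have "b * (k powr p * \<bar>s - t\<bar> powr p) \<le> b * cmod (F (c s) - F (c t)) powr p"
      using b by (intro mult_left_mono) auto
    also have "\<dots> \<le> cmod (deriv F (c s))" using low[OF n(1)] by (simp add: p_def)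
    finally have D: "b * (k powr p * \<bar>s - t\<bar> powr p) \<le> cmod (deriv F (c s))" .
    have pos: "b * (k powr p * \<bar>s - t\<bar> powr p) > 0" using b k x by simp
    have "cmod (deriv F (c s)) > 0" using pos D by linarith
    then have "deriv F (c s) \<noteq> 0" by auto
    have Ks: "K s > 0" using K_pos n(3) by simp
    have "1 / a s = K s / cmod (deriv F (c s))"
      using pairing[OF n(3), symmetric] Ks by simp
    also have "\<dots> \<le> (K t + 1) / (b * (k powr p * \<bar>s - t\<bar> powr p))"
      using D pos Ks n(2) by (intro frac_le) auto
    also have "\<dots> = C * \<bar>s - t\<bar> powr (- p)"
      unfolding C_def powr_minus by (simp add: field_simps)
    finally show "deriv F (c s) \<noteq> 0 \<and> 1 / a s \<le> C * \<bar>s - t\<bar> powr (- p)"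
      using \<open>deriv F (c s) \<noteq> 0\<close> by simp
  qed
qed

lemma inverse_pairing_integrable:
  assumes t: "t \<in> punctured_period"
  obtains d where "d > 0" "{t - d<..<t + d} \<subseteq> punctured_period"
    "\<And>s. s \<in> {t - d<..<t + d} - {t} \<Longrightarrow> deriv F (c s) \<noteq> 0"
    "\<And>e. e \<le> d \<Longrightarrow> set_integrable lebesgue ({t - e<..<t + e} - {t}) (\<lambda>s. 1 / a s)"
proof -
  obtain d p C where d: "d > 0" "p < 1" "{t - d<..<t + d} \<subseteq> punctured_period"
    and bd: "\<And>s. s \<in> {t - d<..<t + d} - {t} \<Longrightarrow> deriv F (c s) \<noteq> 0 \<and> 1 / a s \<le> C * \<bar>s - t\<bar> powr (- p)"
    by (rule pairing_lower_bound[OF t]) (rule that)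
  let ?S = "{t - d<..<t + d} - {t}"
  note S = punctured_interval_lebesgue[of t d]
  have eq: "1 / a s = K s / cmod (deriv F (c s))" if "s \<in> punctured_period" for s
    using pairing[OF that, symmetric] K_pos[OF that] by simp
  have int: "(\<lambda>s. 1 / a s) absolutely_integrable_on ?S"
  proof (rule measurable_bounded_by_integrable_imp_absolutely_integrable[OF _ S])
    have "continuous_on UNIV (deriv F)"
      by (intro holomorphic_on_imp_continuous_on holomorphic_deriv holo) auto
    then have "continuous_on ?S (\<lambda>s. K s / cmod (deriv F (c s)))"
      using bd d(3) by (intro continuous_intros continuous_on_subset[OF cont_K]
        continuous_on_compose2[OF _ continuous_on_subset[OF cont_c]]) auto
    moreover have "continuous_on ?S (\<lambda>s. 1 / a s) \<longleftrightarrow> continuous_on ?S (\<lambda>s. K s / cmod (deriv F (c s)))"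
      using eq d(3) by (intro continuous_on_cong) auto
    ultimately show "(\<lambda>s. 1 / a s) \<in> borel_measurable (lebesgue_on ?S)"
      using S by (intro continuous_imp_measurable_on_sets_lebesgue) auto
    have "(\<lambda>s. C * \<bar>s - t\<bar> powr (- p)) integrable_on {t - d..t + d}"
      using abs_powr_integrable[of p d t] d by (intro integrable_on_mult_right) auto
    then have "(\<lambda>s. \<bar>C\<bar> * \<bar>s - t\<bar> powr (- p)) absolutely_integrable_on {t - d..t + d}"
      using abs_powr_integrable[of p d t] d
      by (intro nonnegative_absolutely_integrable_1 integrable_on_mult_right) auto
    then have "(\<lambda>s. \<bar>C\<bar> * \<bar>s - t\<bar> powr (- p)) absolutely_integrable_on ?S"
      by (rule set_integrable_subset[OF _ S]) auto
    then show "(\<lambda>s. \<bar>C\<bar> * \<bar>s - t\<bar> powr (- p)) integrable_on ?S"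
      by (simp add: absolutely_integrable_on_def)
    fix s assume s: "s \<in> ?S"
    have "s \<in> punctured_period" using s d(3) by auto
    then have "0 \<le> 1 / a s" unfolding eq[OF \<open>s \<in> punctured_period\<close>] using K_pos[of s] by simp
    moreover have "1 / a s \<le> C * \<bar>s - t\<bar> powr (- p)" using bd[OF s] by simp
    moreover have "C * \<bar>s - t\<bar> powr (- p) \<le> \<bar>C\<bar> * \<bar>s - t\<bar> powr (- p)"
      by (intro mult_right_mono) auto
    ultimately show "norm (1 / a s) \<le> \<bar>C\<bar> * \<bar>s - t\<bar> powr (- p)"
      by simp
  qed
  show thesis
  proof (rule that[OF d(1,3)])
    show "deriv F (c s) \<noteq> 0" if "s \<in> ?S" for s using bd[OF that] by simp
    fix e assume "e \<le> d"
    then show "set_integrable lebesgue ({t - e<..<t + e} - {t}) (\<lambda>s. 1 / a s)"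
      by (intro set_integrable_subset[OF int punctured_interval_lebesgue]) auto
  qed
qed

lemma pairing_tendsto_0:
  assumes t: "t \<in> punctured_period" and 0: "deriv F (c t) = 0"
  shows "(a \<longlongrightarrow> 0) (at t)"
proof -
  have "isCont (deriv F) (c t)"
    using holomorphic_on_imp_continuous_on[OF holomorphic_deriv[OF holo open_UNIV]]
    by (simp add: continuous_on_eq_continuous_at)
  then have "isCont (\<lambda>s. cmod (deriv F (c s)) / K s) t"
    using isCont_curve[OF t] isCont_K[OF t] K_pos[OF t]
    by (intro continuous_intros isCont_o2[of t c "deriv F"]) auto
  then have l: "((\<lambda>s. cmod (deriv F (c s)) / K s) \<longlongrightarrow> 0) (at t)" using 0 by (simp add: isCont_def)
  have "\<forall>\<^sub>F s in at t. s \<in> punctured_period"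
    using eventually_at_in_open'[OF open_punctured_period t] .
  then have "\<forall>\<^sub>F s in at t. cmod (deriv F (c s)) / K s = a s"
  proof eventually_elim
    case (elim s)
    then show ?case using pairing[OF elim, symmetric] K_pos[OF elim] by simp
  qed
  from Lim_transform_eventually[OF l this] show ?thesis .
qed

text \<open>Where \<open>F'\<close> does not vanish, \<open>F\<close> has a local holomorphic inverse \<open>g\<close>, and the branch is
  \<open>g (2 cos t)\<close>, which extends to complex parameters. Its derivative vanishes only with \<open>sin t\<close>.\<close>

lemma regular_arc_around:
  assumes s: "s \<in> {0<..<pi}" and nz: "deriv F (c s) \<noteq> 0" and \<epsilon>: "\<epsilon> > 0"
  obtains l r where "l < s" "s < r" "s - \<epsilon> < l" "r < s + \<epsilon>" "0 < l" "r < pi" "regular_spectral_arc F (c ` {l..r})"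
proof -
  obtain R where R: "R > 0" and inj: "inj_on F (ball (c s) R)"
    using has_complex_derivative_locally_injective[OF holo UNIV_I open_UNIV nz] by blast
  let ?B = "ball (c s) R"
  have FB: "F holomorphic_on ?B" using holo by (rule holomorphic_on_subset) simp
  obtain g where g: "g holomorphic_on F ` ?B" and dg: "\<And>z. z \<in> ?B \<Longrightarrow> deriv F z * deriv g (F z) = 1"
    and gF: "\<And>z. z \<in> ?B \<Longrightarrow> g (F z) = z"
    using holomorphic_has_inverse[OF FB open_ball inj] by blast
  have op: "open (F ` ?B)" by (rule open_mapping_thm3[OF FB open_ball inj])
  have sR: "s \<in> punctured_period" using s by (simp add: punctured_period_def)
  have "\<forall>\<^sub>F x in nhds s. c x \<in> ?B \<and> x \<in> {0<..<pi}"
    using isCont_curve[OF sR] s R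
    by (intro eventually_conj topological_tendstoD eventually_nhds_in_open)
      (auto simp: isCont_def tendsto_at_iff_tendsto_nhds)
  then obtain d where d: "d > 0" "\<And>x. dist x s < d \<Longrightarrow> c x \<in> ?B \<and> x \<in> {0<..<pi}"
    unfolding eventually_nhds_metric by blast
  define h where "h = min d \<epsilon> / 2"
  have h: "h > 0" "h < d" "h < \<epsilon>" using d(1) \<epsilon> by (auto simp: h_def)
  define \<mu> where "\<mu> w = g (2 * cos w)" for w
  have near: "c x \<in> ?B" "x \<in> {0<..<pi}" if "x \<in> {s - h..s + h}" for x
  proof -
    have "dist x s < d" using that h by (auto simp: dist_real_def)
    then show "c x \<in> ?B" "x \<in> {0<..<pi}" using d(2) by auto
  qed
  have Fc: "2 * cos (complex_of_real x) = F (c x)" if "x \<in> {s - h..s + h}" for x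
    using on_curve[of x] near(2)[OF that] by simp
  have \<mu>: "\<mu> (of_real x) = c x" if "x \<in> {s - h..s + h}" for x
    unfolding \<mu>_def Fc[OF that] by (rule gF[OF near(1)[OF that]])
  define V where "V = (\<lambda>w :: complex. 2 * cos w) -` (F ` ?B)"
  have V: "open V" unfolding V_def by (intro open_vimage op continuous_intros)
  have xV: "complex_of_real x \<in> V" if "x \<in> {s - h..s + h}" for x
    unfolding V_def using Fc[OF that] near(1)[OF that] by auto
  have \<mu>V: "\<mu> holomorphic_on V"
    unfolding \<mu>_def by (rule holomorphic_on_compose_gen[OF _ g, unfolded o_def]) (auto intro!: holomorphic_intros simp: V_def)
  have "regular_spectral_arc F (c ` {s - h..s + h})"
    unfolding regular_spectral_arc_def
  proof (rule exI[of _ \<mu>], rule exI[of _ "s - h"], rule exI[of _ "s + h"], intro conjI ballI)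
    show "s - h < s + h" using h by simp
    show "\<mu> analytic_on complex_of_real ` {s - h..s + h}"
      using \<mu>V xV analytic_on_subset[of \<mu> V] unfolding analytic_on_open[OF V] by blast
    show "F (\<mu> (of_real x)) = 2 * cos (of_real x)" if "x \<in> {s - h..s + h}" for x
      using \<mu>[OF that] Fc[OF that] by simp
    show "deriv F (\<mu> (of_real x)) \<noteq> 0" if "x \<in> {s - h..s + h}" for x
      using dg[OF near(1)[OF that]] \<mu>[OF that] by auto
    show "c ` {s - h..s + h} = (\<lambda>t. \<mu> (of_real t)) ` {s - h..s + h}"
      using \<mu> by (intro image_cong) auto
    fix x assume "x \<in> {s - h<..<s + h}"
    then have x: "x \<in> {s - h..s + h}" by auto
    have "(g has_field_derivative deriv g (F (c x))) (at (2 * cos (complex_of_real x)))"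
      unfolding Fc[OF x] using g op near(1)[OF x] by (intro holomorphic_derivI) auto
    then have "(\<mu> has_field_derivative deriv g (F (c x)) * (2 * (- sin (of_real x)))) (at (of_real x))"
      unfolding \<mu>_def by (intro DERIV_chain2[of g]) (auto intro!: derivative_eq_intros)
    then have "deriv \<mu> (of_real x) = deriv g (F (c x)) * (2 * (- sin (of_real x)))" by (rule DERIV_imp_deriv)
    moreover have "deriv g (F (c x)) \<noteq> 0" using dg[OF near(1)[OF x]] by auto
    moreover have "sin x > 0" using near(2)[OF x] by (intro sin_gt_zero) auto
    then have "sin (complex_of_real x) \<noteq> 0" by (simp add: sin_of_real)
    ultimately show "deriv \<mu> (of_real x) \<noteq> 0" by simp
  qed
  moreover have "s - h \<in> {0<..<pi}" "s + h \<in> {0<..<pi}"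
    using near(2)[of "s - h"] near(2)[of "s + h"] h by auto
  ultimately show thesis using that[of "s - h" "s + h"] h by auto
qed

end

section \<open>Multiple eigenvalues as spectral singularities\<close>

lemma eigenvalue_in_spectrum:
  assumes "eigenvalue T z"
  shows "z \<in> op_spectrum T"
proof (rule ccontr)
  assume "z \<notin> op_spectrum T"
  then obtain C where "\<forall>(y, h)\<in>T. L2_norm y \<le> C * L2_norm (\<lambda>x. h x - z * y x)"
    unfolding op_spectrum_def resolvent_set_def by blast
  then have C: "L2_norm y \<le> C * L2_norm (\<lambda>x. h x - z * y x)" if "(y, h) \<in> T" for y h
    using that by blast
  obtain y where y: "(y, \<lambda>x. z * y x) \<in> T" "L2_norm y \<noteq> 0"
    using assms unfolding eigenvalue_def by blast
  have "L2_norm y \<le> 0" using C[OF y(1)] by (simp add: L2_norm_def)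
  moreover have "L2_norm y \<ge> 0" by (simp add: L2_norm_def)
  ultimately show False using y(2) by simp
qed

lemma cis_diff_nonzero: "t \<in> punctured_period \<Longrightarrow> cis t \<noteq> cis (- t)"
  using sin_nonzero_punctured_period[of t] by (simp add: complex_eq_iff)

lemma uminus_punctured_period: "t \<in> punctured_period \<Longrightarrow> - t \<in> punctured_period"
  by (auto simp: punctured_period_def)

context hill_system begin

lemma discriminant_holomorphic: "discriminant holomorphic_on UNIV"
  using discriminant_has_derivative by (auto simp: holomorphic_on_open)

lemma deriv_discriminant: "deriv discriminant z = discriminant_deriv z"
  by (rule DERIV_imp_deriv[OF discriminant_has_derivative])

text \<open>A value taken by some \<open>ev n t\<close> has positive multiplicity, so it is a root.\<close>

lemma eigenvalue_numbering_on_curve: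
  assumes ev: "eigenvalue_numbering F ev" and t: "t \<in> {-pi..pi}"
  shows "F (ev n t) = 2 * cos (of_real t)"
proof -
  have main: "F (ev n s) = 2 * cos (of_real s)" if "s \<in> {0..pi}" for s
  proof -
    have "finite {m. ev m s = ev n s}" "card {m. ev m s = ev n s} = root_multiplicity F s (ev n s)"
      using ev that unfolding eigenvalue_numbering_def by auto
    then have "root_multiplicity F s (ev n s) \<noteq> 0" by (metis (mono_tags) card_eq_0_iff empty_iff mem_Collect_eq)
    then show ?thesis by (auto simp: root_multiplicity_def split: if_splits)
  qed
  show ?thesis
  proof (cases "t \<ge> 0")
    case False
    then have "F (ev n (- t)) = 2 * cos (of_real (- t))" using main[of "- t"] t by auto
    then show ?thesis using ev unfolding eigenvalue_numbering_def by simp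
  qed (use main[of t] t in auto)
qed

lemma eigenvalue_numbering_continuous:
  assumes ev: "eigenvalue_numbering F ev"
  shows "continuous_on punctured_period (ev n)"
proof -
  have c: "continuous_on {0..pi} (ev n)" and even: "ev n (- t) = ev n t" for t
    using ev unfolding eigenvalue_numbering_def by auto
  have "continuous_on {0<..<pi} (ev n)" by (rule continuous_on_subset[OF c]) auto
  moreover have "continuous_on {-pi<..<0} (\<lambda>t. ev n (- t))"
    by (rule continuous_on_compose2[OF c]) (auto intro!: continuous_intros)
  ultimately show ?thesis
    unfolding punctured_period_def even by (intro continuous_on_open_Un) auto
qed

lemma spectral_branch_numbering:
  assumes ev: "eigenvalue_numbering discriminant ev" and ef: "eigenfunction_system q ev \<Psi> \<Psi>s"
  shows "spectral_branch discriminant (ev n) (\<lambda>t. cmod (eig_alpha \<Psi> \<Psi>s n t))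
           (\<lambda>t. 2 * \<bar>sin t\<bar> * inv_wronskian (ev n t) (cis t) (cis (- t)))"
proof -
  have even: "ev n (- t) = ev n t" for t
    using ev unfolding eigenvalue_numbering_def by auto
  have pair: "inv_wronskian (ev n t) (cis t) (cis (- t)) > 0"
    "floquet_projection_size (ev n t) (cis t) (cis (- t)) \<noteq> 0"
    "cmod (eig_alpha \<Psi> \<Psi>s n t) * (2 * \<bar>sin t\<bar> * inv_wronskian (ev n t) (cis t) (cis (- t)))
      = cmod (discriminant_deriv (ev n t))" if t: "t \<in> punctured_period" for t
  proof -
    have "normalized_eigenfunction (hill_op q t) (ev n t) (\<Psi> n t)"
      "normalized_eigenfunction (hill_op q (- t)) (ev n t) (\<Psi> n (- t))"
      "normalized_eigenfunction (adjoint_graph (hill_op q t)) (cnj (ev n t)) (\<Psi>s n t)"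
      using ef even[of t] unfolding eigenfunction_system_def by metis+
    from cmod_eigenfunction_pairing[OF sin_nonzero_punctured_period[OF t] this]
    show "inv_wronskian (ev n t) (cis t) (cis (- t)) > 0"
    "floquet_projection_size (ev n t) (cis t) (cis (- t)) \<noteq> 0"
    "cmod (eig_alpha \<Psi> \<Psi>s n t) * (2 * \<bar>sin t\<bar> * inv_wronskian (ev n t) (cis t) (cis (- t)))
      = cmod (discriminant_deriv (ev n t))"
      by (auto simp: eig_alpha_def)
  qed
  note cont = eigenvalue_numbering_continuous[OF ev, of n]
  show ?thesis
  proof
    show "continuous_on punctured_period (\<lambda>t. 2 * \<bar>sin t\<bar> * inv_wronskian (ev n t) (cis t) (cis (- t)))"
      unfolding continuous_on_eq_continuous_at[OF open_punctured_period]
    proof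
      fix t assume t: "t \<in> punctured_period"
      have "isCont (ev n) t"
        using cont t open_punctured_period by (auto simp: continuous_on_eq_continuous_at)
      moreover have "isCont cis t" "isCont (\<lambda>s. cis (- s)) t"
        unfolding cis_conv_exp by (intro continuous_intros)+
      ultimately have "isCont (\<lambda>s. inv_wronskian (ev n s) (cis s) (cis (- s))) t"
        unfolding isCont_def
        by (intro inv_wronskian_tendsto cis_diff_nonzero[OF t] pair(2)[OF t]) auto
      then show "isCont (\<lambda>t. 2 * \<bar>sin t\<bar> * inv_wronskian (ev n t) (cis t) (cis (- t))) t"
        by (intro continuous_intros)
    qed
  qed (use pair sin_nonzero_punctured_period discriminant_holomorphic cont
      eigenvalue_numbering_on_curve[OF ev] in \<open>auto simp: deriv_discriminant\<close>)
qed

end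

text \<open>Along points \<open>s k\<close> tending to \<open>t0\<close> from the right \<open>\<alpha>\<close> tends to \<open>0\<close>. Each \<open>ev n (s k)\<close> has a regular arc
  around it that stays away from \<open>z0\<close>, where \<open>F'\<close> vanishes.\<close>

lemma multiple_eigenvalue_spectral_singularity:
  assumes branch: "spectral_branch F (ev n) (\<lambda>t. cmod (\<alpha> n t)) K"
    and t0: "t0 \<in> {0<..<pi}" and z0: "ev n t0 = z0" "deriv F z0 = 0"
    and spec: "z0 \<in> hill_spectrum q"
  shows "spectral_singularity q F ev \<alpha> z0"
  unfolding spectral_singularity_def
proof (intro conjI allI impI spec)
  interpret spectral_branch F "ev n" "\<lambda>t. cmod (\<alpha> n t)" K by (rule branch)
  fix \<epsilon> :: real assume \<epsilon>: "\<epsilon> > 0"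
  have tp: "t0 \<in> punctured_period" using t0 by (simp add: punctured_period_def)
  obtain d where d: "d > 0" "\<And>s. s \<in> {t0 - d<..<t0 + d} - {t0} \<Longrightarrow> deriv F (ev n s) \<noteq> 0"
    by (rule inverse_pairing_integrable[OF tp]) (rule that)
  have "\<forall>\<^sub>F s in nhds t0. ev n s \<in> ball z0 \<epsilon> \<and> s \<in> {0<..<pi} \<and> s \<in> {t0 - d<..<t0 + d}"
    using isCont_curve[OF tp] t0 \<epsilon> d(1) z0(1)
    by (intro eventually_conj topological_tendstoD eventually_nhds_in_open)
      (auto simp: isCont_def tendsto_at_iff_tendsto_nhds)
  then obtain \<delta> where \<delta>: "\<delta> > 0"
    and near: "\<And>s. dist s t0 < \<delta> \<Longrightarrow> ev n s \<in> ball z0 \<epsilon> \<and> s \<in> {0<..<pi} \<and> s \<in> {t0 - d<..<t0 + d}"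
    unfolding eventually_nhds_metric by blast
  \<comment> \<open>The shift by 2 keeps an interval of radius \<open>h k\<close> around \<open>s k\<close> between \<open>t0\<close> and \<open>t0 + \<delta>\<close>.\<close>
  define h where "h k = \<delta> / real (k + 2)" for k
  have h: "h k > 0" "2 * h k \<le> \<delta>" for k using \<delta> by (auto simp: h_def field_simps)
  define s where "s k = t0 + h k" for k
  have "\<exists>\<gamma>. regular_spectral_arc F \<gamma> \<and> \<gamma> \<subseteq> ev n ` {0..pi} \<and> \<gamma> \<subseteq> ball z0 \<epsilon> \<and> ev n (s k) \<in> \<gamma>" for k
  proof -
    have "dist (s k) t0 < \<delta>" using h[of k] by (simp add: s_def dist_real_def)
    then have sk: "s k \<in> {0<..<pi}" "deriv F (ev n (s k)) \<noteq> 0"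
      using near[of "s k"] d(2)[of "s k"] h[of k] by (auto simp: s_def)
    obtain l r where lr: "l < s k" "s k < r" "s k - h k < l" "r < s k + h k" "0 < l" "r < pi"
      and arc: "regular_spectral_arc F (ev n ` {l..r})"
      by (rule regular_arc_around[OF sk h(1)]) (rule that)
    have "ev n x \<in> ball z0 \<epsilon>" if "x \<in> {l..r}" for x
    proof -
      have "dist x t0 < \<delta>" using that lr h[of k] by (auto simp: s_def dist_real_def)
      then show ?thesis using near by blast
    qed
    then show ?thesis using arc lr by (intro exI[of _ "ev n ` {l..r}"]) auto
  qed
  then obtain \<gamma> where \<gamma>: "\<And>k. regular_spectral_arc F (\<gamma> k)" "\<And>k. \<gamma> k \<subseteq> ev n ` {0..pi}"
    "\<And>k. \<gamma> k \<subseteq> ball z0 \<epsilon>" "\<And>k. ev n (s k) \<in> \<gamma> k"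
    by metis
  have "(\<lambda>k. \<delta> * inverse (real (k + 2))) \<longlonglongrightarrow> \<delta> * 0"
    by (intro tendsto_mult tendsto_const LIMSEQ_ignore_initial_segment[OF lim_inverse_n])
  then have "h \<longlonglongrightarrow> 0" by (simp add: h_def[abs_def] divide_inverse)
  then have "s \<longlonglongrightarrow> t0 + 0" unfolding s_def[abs_def] by (intro tendsto_intros)
  then have "filterlim s (at t0) sequentially"
    using h(1) by (auto simp: filterlim_at s_def intro!: always_eventually) (metis less_irrefl)
  from filterlim_compose[OF pairing_tendsto_0[OF tp] this]
  have "(\<lambda>k. cmod (\<alpha> n (s k))) \<longlonglongrightarrow> 0" using z0 by simp
  then have "(\<lambda>k. ennreal (cmod (\<alpha> n (s k)))) \<longlonglongrightarrow> ennreal 0" by (rule tendsto_ennrealI)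
  then have "(\<lambda>k. inverse (ennreal (cmod (\<alpha> n (s k))))) \<longlonglongrightarrow> inverse (ennreal 0)"
    by (rule continuous_on_tendsto_compose[OF continuous_on_inverse_ennreal[OF continuous_on_id[of UNIV]]]) auto
  moreover have "inverse (ennreal 0) = \<infinity>" by simp
  ultimately have lim: "(\<lambda>k. inverse (ennreal (cmod (\<alpha> n (s k))))) \<longlonglongrightarrow> \<infinity>"
    by (simp only:)
  have "inverse (ennreal (cmod (\<alpha> n (s k)))) \<le> projection_norm ev \<alpha> n (\<gamma> k)" for k
  proof -
    have "dist (s k) t0 < \<delta>" using h[of k] by (simp add: s_def dist_real_def)
    then have "s k \<in> {-pi<..pi}" using near[of "s k"] by auto
    then show ?thesis unfolding projection_norm_def using \<gamma>(4)[of k] by (intro SUP_upper) auto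
  qed
  then have "(\<lambda>k. projection_norm ev \<alpha> n (\<gamma> k)) \<longlonglongrightarrow> \<infinity>"
    by (intro tendsto_sandwich[OF always_eventually always_eventually lim tendsto_const])
      (simp_all only: infinity_ennreal_def top_greatest simp_thms)
  then show "\<exists>\<gamma> n. (\<forall>k. regular_spectral_arc F (\<gamma> k) \<and> \<gamma> k \<subseteq> ev (n k) ` {0..pi} \<and> \<gamma> k \<subseteq> ball z0 \<epsilon>) \<and>
        (\<lambda>k. projection_norm ev \<alpha> (n k) (\<gamma> k)) \<longlonglongrightarrow> \<infinity>"
    using \<gamma>(1-3) by (intro exI[of _ \<gamma>] exI[of _ "\<lambda>_. n"]) auto
qed

text \<open>Close to \<open>t\<close> and \<open>- t\<close> the derivative of \<open>F\<close> vanishes on the branch at these two points only, so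
  that the excluded set reduces to them and the bound for \<open>1 / \<alpha>\<close> applies around each.\<close>

lemma not_essential_at_branch_point:
  assumes branch: "spectral_branch F (ev n) (\<lambda>t. cmod (\<alpha> n t)) K"
    and t: "t \<in> punctured_period" and even: "ev n (- t) = ev n t"
    and 0: "deriv F (ev n t) = 0"
    and eig: "\<And>s. eigenvalue (hill_op q s) (ev n s)"
  shows "\<exists>\<epsilon>>0. set_integrable lebesgue
     (({t - \<epsilon><..<t + \<epsilon>} \<union> {- t - \<epsilon><..<- t + \<epsilon>}) - multiple_set q F ev n) (\<lambda>s. 1 / cmod (\<alpha> n s))"
proof -
  interpret spectral_branch F "ev n" "\<lambda>t. cmod (\<alpha> n t)" K by (rule branch)
  have t': "- t \<in> punctured_period" using t by (rule uminus_punctured_period)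
  have mult: "s \<in> multiple_set q F ev n \<longleftrightarrow> deriv F (ev n s) = 0" if s: "s \<in> punctured_period" for s
  proof -
    have "s \<in> {-pi<..pi}" "s \<in> {-pi..pi}" using s by (auto simp: punctured_period_def)
    then show ?thesis using eig on_curve[of s] root_multiplicity_ge_2_iff[OF holo nonconstant]
      by (auto simp: multiple_set_def multiple_eigenvalue_def)
  qed
  obtain d where d: "d > 0" "{t - d<..<t + d} \<subseteq> punctured_period"
    "\<And>s. s \<in> {t - d<..<t + d} - {t} \<Longrightarrow> deriv F (ev n s) \<noteq> 0"
    "\<And>e. e \<le> d \<Longrightarrow> set_integrable lebesgue ({t - e<..<t + e} - {t}) (\<lambda>s. 1 / cmod (\<alpha> n s))"
    by (rule inverse_pairing_integrable[OF t]) (rule that)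
  obtain d' where d': "d' > 0" "{- t - d'<..<- t + d'} \<subseteq> punctured_period"
    "\<And>s. s \<in> {- t - d'<..<- t + d'} - {- t} \<Longrightarrow> deriv F (ev n s) \<noteq> 0"
    "\<And>e. e \<le> d' \<Longrightarrow> set_integrable lebesgue ({- t - e<..<- t + e} - {- t}) (\<lambda>s. 1 / cmod (\<alpha> n s))"
    by (rule inverse_pairing_integrable[OF t']) (rule that)
  define e where "e = min d d'"
  have e: "e > 0" "e \<le> d" "e \<le> d'" using d(1) d'(1) by (auto simp: e_def)
  have "({t - e<..<t + e} \<union> {- t - e<..<- t + e}) - multiple_set q F ev n
     = ({t - e<..<t + e} - {t}) \<union> ({- t - e<..<- t + e} - {- t})" (is "?L = ?R")
  proof
    have "t \<in> multiple_set q F ev n" "- t \<in> multiple_set q F ev n"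
      using mult[OF t] mult[OF t'] 0 even by auto
    then show "?L \<subseteq> ?R" by auto
    show "?R \<subseteq> ?L"
    proof
      fix s assume s: "s \<in> ?R"
      then have "deriv F (ev n s) \<noteq> 0" using d(3)[of s] d'(3)[of s] e by auto
      moreover have "s \<in> {t - d<..<t + d} \<union> {- t - d'<..<- t + d'}" using s e by auto
      then have "s \<in> punctured_period" using d(2) d'(2) by blast
      ultimately show "s \<in> ?L" using s mult by auto
    qed
  qed
  moreover have "set_integrable lebesgue ?R (\<lambda>s. 1 / cmod (\<alpha> n s))"
    by (rule set_integrable_Un[OF d(4)[OF e(2)] d'(4)[OF e(3)]]; rule punctured_interval_lebesgue)
  ultimately show ?thesis using e(1) by auto
qed

theorem theorem1:
  fixes q :: "real \<Rightarrow> complex"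
    and \<theta> \<phi> :: "real \<Rightarrow> complex \<Rightarrow> complex"
    and F :: "complex \<Rightarrow> complex"
    and ev :: "int \<Rightarrow> real \<Rightarrow> complex"
    and \<Psi> \<Psi>s :: "int \<Rightarrow> real \<Rightarrow> real \<Rightarrow> complex"
    and \<alpha> :: "int \<Rightarrow> real \<Rightarrow> complex"
    and t0 :: real and z0 :: complex
  assumes "hill_potential q"
    and "fundamental_solutions q \<theta> \<phi>"
    and "F = hill_discriminant \<theta> \<phi>"
    and "eigenvalue_numbering F ev"
    and "eigenfunction_system q ev \<Psi> \<Psi>s"
    and "\<alpha> = eig_alpha \<Psi> \<Psi>s"
    and "t0 \<in> {0<..<pi}"
    and "multiple_eigenvalue q F t0 z0"
  shows "spectral_singularity q F ev \<alpha> z0 \<and> \<not> essential_spectral_singularity q F ev \<alpha> z0"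
proof -
  interpret hill_system q \<theta> "\<lambda>x z. vector_derivative (\<lambda>x. \<theta> x z) (at x)"
      \<phi> "\<lambda>x z. vector_derivative (\<lambda>x. \<phi> x z) (at x)"
  proof
    fix z
    show "hill_solution q z (\<lambda>x. \<theta> x z) (\<lambda>x. vector_derivative (\<lambda>x. \<theta> x z) (at x))"
      "hill_solution q z (\<lambda>x. \<phi> x z) (\<lambda>x. vector_derivative (\<lambda>x. \<phi> x z) (at x))"
      using assms(2) hill_expr_imp_solution[of UNIV q "\<lambda>x. \<theta> x z" z] hill_expr_imp_solution[of UNIV q "\<lambda>x. \<phi> x z" z]
      unfolding fundamental_solutions_def by auto
  qed (use assms(2) in \<open>auto simp: fundamental_solutions_def\<close>)
  have F: "F = discriminant"
    by (simp add: assms(3) fun_eq_iff hill_discriminant_def discriminant_def)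
  have branch: "\<exists>K. spectral_branch F (ev n) (\<lambda>t. cmod (\<alpha> n t)) K" for n
    using spectral_branch_numbering assms(4-6) unfolding F by blast
  have t0: "t0 \<in> {-pi..pi}" "t0 \<in> {-pi<..pi}" using assms(7) by auto
  have eig: "eigenvalue (hill_op q t0) z0" and mult: "root_multiplicity F t0 z0 \<ge> 2"
    using assms(8) by (auto simp: multiple_eigenvalue_def)
  have "card {n. ev n t0 = z0} \<noteq> 0"
    using assms(4,7) mult unfolding eigenvalue_numbering_def by auto
  then obtain n where n: "ev n t0 = z0" by (metis (mono_tags, lifting) Collect_empty_eq card.empty)
  obtain K where K: "spectral_branch F (ev n) (\<lambda>t. cmod (\<alpha> n t)) K" using branch by blast
  have F0: "F z0 = 2 * cos (of_real t0)" "deriv F z0 = 0"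
    using mult root_multiplicity_ge_2_iff[OF spectral_branch.holo[OF K] spectral_branch.nonconstant[OF K]] by auto
  have "z0 \<in> hill_spectrum q"
    using eigenvalue_in_spectrum[OF eig] t0(2) unfolding hill_spectrum_def by blast
  from multiple_eigenvalue_spectral_singularity[of F ev n \<alpha>, OF K assms(7) n F0(2) this]
  have sing: "spectral_singularity q F ev \<alpha> z0" .
  have "\<not> essential_spectral_singularity q F ev \<alpha> z0"
  proof
    assume "essential_spectral_singularity q F ev \<alpha> z0"
    then obtain t m where t: "t \<in> {-pi<..pi}" and m: "z0 = ev m t" and ess: "\<And>\<epsilon>. \<epsilon> > 0 \<Longrightarrow> \<not> set_integrable lebesgue
       (({t - \<epsilon><..<t + \<epsilon>} \<union> {- t - \<epsilon><..<- t + \<epsilon>}) - multiple_set q F ev m) (\<lambda>s. 1 / cmod (\<alpha> m s))"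
      unfolding essential_spectral_singularity_def by (elim bexE conjE exE) (rule that, auto)
    have "F z0 = 2 * cos (of_real t)"
      unfolding m using t by (intro eigenvalue_numbering_on_curve[OF assms(4)]) auto
    then have "cos t = cos t0" using F0(1) by (simp add: cos_of_real)
    then have "cos \<bar>t\<bar> = cos t0" by simp
    moreover have "0 \<le> \<bar>t\<bar>" "\<bar>t\<bar> \<le> pi" "0 \<le> t0" "t0 \<le> pi" using t assms(7) by auto
    ultimately have "\<bar>t\<bar> = t0" using cos_inj_pi by blast
    then have "t = t0 \<or> t = - t0" by linarith
    then have tp: "t \<in> punctured_period"
      using assms(7) unfolding punctured_period_def by (elim disjE) simp_all
    obtain K' where K': "spectral_branch F (ev m) (\<lambda>t. cmod (\<alpha> m t)) K'" using branch by blast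
    have "eigenvalue (hill_op q s) (ev m s)" for s
      using assms(5) unfolding eigenfunction_system_def normalized_eigenfunction_def eigenvalue_def
      by (metis zero_neq_one)
    moreover have "ev m (- t) = ev m t" using assms(4) unfolding eigenvalue_numbering_def by blast
    moreover have "deriv F (ev m t) = 0" using F0(2) m by simp
    ultimately have "\<exists>\<epsilon>>0. set_integrable lebesgue
       (({t - \<epsilon><..<t + \<epsilon>} \<union> {- t - \<epsilon><..<- t + \<epsilon>}) - multiple_set q F ev m) (\<lambda>s. 1 / cmod (\<alpha> m s))"
      by (intro not_essential_at_branch_point[of F ev m \<alpha> K' t q, OF K' tp])
    then show False using ess by blast
  qed
  with sing show ?thesis ..
qed

end
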